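(* Let $A,B\colon\mathsf{Set}\to\mathsf{Set}$ be $\omega$-continuous functors. The right Kan extension $\mathrm{Ran}_{\bar A}\bar B$ is given by $\mathrm{Ran}_{\bar A}\bar B(X)=\{\alpha\colon A_\omega^X\to B_\omega\mid\alpha\text{ is a causal function}\}$ and, for $h\colon X\to Y$, $\mathrm{Ran}_{\bar A}\bar B(h)(\alpha)=\lambda f.\,\alpha(f\circ h)$; its counit $\epsilon$ satisfies $\epsilon_\omega(\alpha)=\alpha(\mathrm{id}_{A_\omega})$ for $\alpha\colon A_\omega^{A_\omega}\to B_\omega$. Given a functor $F$ and a natural transformation $\alpha\colon F\bar A\Rightarrow\bar B$, the unique natural transformation $\hat\alpha\colon F\Rightarrow\mathrm{Ran}_{\bar A}\bar B$ with $\epsilon\circ\hat\alpha\bar A=\alpha$ is given by $\hat\alpha_X(S)(f)=\alpha_\omega(Ff(S))$ for $S\in FX$ and $f\colon X\to A_\omega$; equivalently, $\hat\alpha$ is the unique natural transformation with $\epsilon_\omega\circ\hat\alpha_{A_\omega}=\alpha_\omega$.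
   Context: Final sequence of $A$ on $\mathsf{Set}$: $A_0=1$, $A_{i+1}=AA_i$, $A_j=\lim_{i<j}A_i$ at limit $j$, connecting maps $A_{j,i}\colon A_j\to A_i$ with $A_{i,i}=\mathrm{id}$, $A_{j+1,i+1}=AA_{j,i}$; functor $\bar A\colon\mathrm{Ord}^{op}\to\mathsf{Set}$. $\omega$-continuous: preserves limits of $\omega^{op}$-chains. A right Kan extension of $\bar B$ along $\bar A$ is $(R,\epsilon)$ with $R\colon\mathsf{Set}\to\mathsf{Set}$ and $\epsilon\colon R\bar A\Rightarrow\bar B$ such that every $\alpha\colon H\bar A\Rightarrow\bar B$ factors as $\epsilon\circ\hat\alpha\bar A$ for a unique $\hat\alpha\colon H\Rightarrow R$. A function $\alpha\colon A_\omega^X\to B_\omega$ is a causal function if for all $h,k\in A_\omega^X$ and $i<\omega$, $A_{\omega,i}\circ h=A_{\omega,i}\circ k$ implies $B_{\omega,i}(\alpha(h))=B_{\omega,i}(\alpha(k))$. *)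

theory Defs
  imports "HOL-Library.FuncSet"
begin

text \<open>
  HOL has no type of all sets, so \<open>Set\<close> is the category of sets of an arbitrary model \<open>'v\<close> of ZFC;
  replacement and separation are the full second-order axioms, and choice is inherited from HOL.
\<close>

class zfc_universe =
  fixes elts :: "'a \<Rightarrow> 'a set"
  assumes extensionality: "elts x = elts y \<Longrightarrow> x = y"
    and foundation: "wf {(x, y). x \<in> elts y}"
    and separation: "X \<subseteq> elts a \<Longrightarrow> X \<in> range elts"
    and union: "(\<Union>x\<in>elts a. elts x) \<in> range elts"
    and powerset: "{x. elts x \<subseteq> elts a} \<in> range elts"
    and replacement: "f ` elts a \<in> range elts"
    and infinity: "\<exists>a. (\<exists>z\<in>elts a. elts z = {}) \<and> (\<forall>x\<in>elts a. \<exists>y\<in>elts a. elts y = insert x (elts x))"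

definition vset :: "'v set \<Rightarrow> 'v::zfc_universe" where
  "vset X = (THE v. elts v = X)"

definition vpair :: "'v \<Rightarrow> 'v \<Rightarrow> 'v::zfc_universe" where
  "vpair a b = vset {vset {a}, vset {a, b}}"

definition vlambda :: "'v \<Rightarrow> ('v \<Rightarrow> 'v) \<Rightarrow> 'v::zfc_universe" where
  "vlambda X f = vset ((\<lambda>x. vpair x (f x)) ` elts X)"

definition vapp :: "'v \<Rightarrow> 'v \<Rightarrow> 'v::zfc_universe" where
  "vapp f x = (THE y. vpair x y \<in> elts f)"

text \<open>
  Morphisms of \<open>Set\<close> are extensional HOL functions; \<open>vexp Y X\<close> is the exponential \<open>Y\<^sup>X\<close>, an object
  whose elements are the graphs of the morphisms from \<open>X\<close> to \<open>Y\<close>.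
\<close>

definition hom :: "'v \<Rightarrow> 'v \<Rightarrow> ('v \<Rightarrow> 'v::zfc_universe) set" where
  "hom X Y = elts X \<rightarrow>\<^sub>E elts Y"

definition idm :: "'v \<Rightarrow> 'v \<Rightarrow> 'v::zfc_universe" where
  "idm X = (\<lambda>x\<in>elts X. x)"

definition vexp :: "'v \<Rightarrow> 'v \<Rightarrow> 'v::zfc_universe" where
  "vexp Y X = vset (vlambda X ` hom X Y)"

definition vfun :: "'v \<Rightarrow> 'v \<Rightarrow> 'v \<Rightarrow> 'v::zfc_universe" where
  "vfun X f = (\<lambda>x\<in>elts X. vapp f x)"


subsection \<open>Ordinals (von Neumann)\<close>

definition ordinal :: "'v::zfc_universe \<Rightarrow> bool" where
  "ordinal i \<longleftrightarrow> (\<forall>x\<in>elts i. elts x \<subseteq> elts i) \<and> (\<forall>x\<in>elts i. \<forall>y\<in>elts x. elts y \<subseteq> elts x)"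

definition ordinals :: "'v::zfc_universe set" where
  "ordinals = {i. ordinal i}"

definition ord_le :: "'v::zfc_universe \<Rightarrow> 'v \<Rightarrow> bool" where
  "ord_le i j \<longleftrightarrow> elts i \<subseteq> elts j"

definition ord_zero :: "'v::zfc_universe" where
  "ord_zero = vset {}"

definition ord_succ :: "'v \<Rightarrow> 'v::zfc_universe" where
  "ord_succ i = vset (insert i (elts i))"

definition limit_ordinal :: "'v::zfc_universe \<Rightarrow> bool" where
  "limit_ordinal j \<longleftrightarrow> ordinal j \<and> j \<noteq> ord_zero \<and> (\<nexists>i. ordinal i \<and> j = ord_succ i)"

primrec ord_of_nat :: "nat \<Rightarrow> 'v::zfc_universe" where
  "ord_of_nat 0 = ord_zero"
| "ord_of_nat (Suc n) = ord_succ (ord_of_nat n)"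

definition ord_omega :: "'v::zfc_universe" where
  "ord_omega = vset (range ord_of_nat)"


subsection \<open>Functors and natural transformations\<close>

text \<open>\<open>Ar F X Y f\<close> is the action of \<open>F\<close> on the morphism \<open>f\<close> from \<open>X\<close> to \<open>Y\<close>.\<close>

record 'v set_functor =
  Ob :: "'v \<Rightarrow> 'v"
  Ar :: "'v \<Rightarrow> 'v \<Rightarrow> ('v \<Rightarrow> 'v) \<Rightarrow> 'v \<Rightarrow> 'v"

definition is_functor :: "'v::zfc_universe set_functor \<Rightarrow> bool" where
  "is_functor F \<longleftrightarrow>
     (\<forall>X Y. \<forall>f\<in>hom X Y. Ar F X Y f \<in> hom (Ob F X) (Ob F Y)) \<and>
     (\<forall>X. Ar F X X (idm X) = idm (Ob F X)) \<and>
     (\<forall>X Y Z. \<forall>f\<in>hom X Y. \<forall>g\<in>hom Y Z.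
        Ar F X Z (compose (elts X) g f) = compose (elts (Ob F X)) (Ar F Y Z g) (Ar F X Y f))"

definition is_nat_trans :: "'v::zfc_universe set_functor \<Rightarrow> 'v set_functor \<Rightarrow> ('v \<Rightarrow> 'v \<Rightarrow> 'v) \<Rightarrow> bool" where
  "is_nat_trans F G \<gamma> \<longleftrightarrow>
     (\<forall>X. \<gamma> X \<in> hom (Ob F X) (Ob G X)) \<and>
     (\<forall>X Y. \<forall>f\<in>hom X Y.
        compose (elts (Ob F X)) (\<gamma> Y) (Ar F X Y f) = compose (elts (Ob F X)) (Ar G X Y f) (\<gamma> X))"

text \<open>
  A contravariant \<open>Set\<close>-valued functor on a class \<open>I\<close> of ordinals; \<open>cmap D j i\<close> is the connecting map
  from \<open>cob D j\<close> to \<open>cob D i\<close> for \<open>i \<le> j\<close>.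
\<close>

record 'v chain =
  cob :: "'v \<Rightarrow> 'v"
  cmap :: "'v \<Rightarrow> 'v \<Rightarrow> 'v \<Rightarrow> 'v"

definition is_chain :: "'v::zfc_universe set \<Rightarrow> 'v chain \<Rightarrow> bool" where
  "is_chain I D \<longleftrightarrow>
     (\<forall>i\<in>I. \<forall>j\<in>I. ord_le i j \<longrightarrow> cmap D j i \<in> hom (cob D j) (cob D i)) \<and>
     (\<forall>i\<in>I. cmap D i i = idm (cob D i)) \<and>
     (\<forall>i\<in>I. \<forall>j\<in>I. \<forall>k\<in>I. ord_le i j \<longrightarrow> ord_le j k \<longrightarrow>
        cmap D k i = compose (elts (cob D k)) (cmap D j i) (cmap D k j))"

definition is_chain_trans :: "'v::zfc_universe set \<Rightarrow> 'v chain \<Rightarrow> 'v chain \<Rightarrow> ('v \<Rightarrow> 'v \<Rightarrow> 'v) \<Rightarrow> bool" where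
  "is_chain_trans I D E \<alpha> \<longleftrightarrow>
     (\<forall>i\<in>I. \<alpha> i \<in> hom (cob D i) (cob E i)) \<and>
     (\<forall>i\<in>I. \<forall>j\<in>I. ord_le i j \<longrightarrow>
        compose (elts (cob D j)) (\<alpha> i) (cmap D j i) = compose (elts (cob D j)) (cmap E j i) (\<alpha> j))"

definition map_chain :: "'v::zfc_universe set_functor \<Rightarrow> 'v chain \<Rightarrow> 'v chain" where
  "map_chain F D = \<lparr>cob = (\<lambda>i. Ob F (cob D i)),
                    cmap = (\<lambda>j i. Ar F (cob D j) (cob D i) (cmap D j i))\<rparr>"


subsection \<open>Limits, continuity and the final sequence\<close>

definition is_cone :: "'v::zfc_universe set \<Rightarrow> 'v chain \<Rightarrow> 'v \<Rightarrow> ('v \<Rightarrow> 'v \<Rightarrow> 'v) \<Rightarrow> bool" where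
  "is_cone I D L p \<longleftrightarrow>
     (\<forall>i\<in>I. p i \<in> hom L (cob D i)) \<and>
     (\<forall>i\<in>I. \<forall>j\<in>I. ord_le i j \<longrightarrow> compose (elts L) (cmap D j i) (p j) = p i)"

definition is_limit_cone :: "'v::zfc_universe set \<Rightarrow> 'v chain \<Rightarrow> 'v \<Rightarrow> ('v \<Rightarrow> 'v \<Rightarrow> 'v) \<Rightarrow> bool" where
  "is_limit_cone I D L p \<longleftrightarrow>
     is_cone I D L p \<and>
     (\<forall>Z q. is_cone I D Z q \<longrightarrow> (\<exists>!u. u \<in> hom Z L \<and> (\<forall>i\<in>I. compose (elts Z) (p i) u = q i)))"

definition omega_continuous :: "'v::zfc_universe set_functor \<Rightarrow> bool" where
  "omega_continuous F \<longleftrightarrow>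
     (\<forall>D L p. is_chain (elts ord_omega) D \<and> is_limit_cone (elts ord_omega) D L p \<longrightarrow>
        is_limit_cone (elts ord_omega) (map_chain F D) (Ob F L) (\<lambda>i. Ar F L (cob D i) (p i)))"

text \<open>
  The final sequence is determined only up to the choice of a terminal object and of limits; the
  predicate admits every choice.
\<close>

definition is_final_sequence :: "'v::zfc_universe set_functor \<Rightarrow> 'v chain \<Rightarrow> bool" where
  "is_final_sequence F D \<longleftrightarrow>
     is_chain ordinals D \<and>
     is_singleton (elts (cob D ord_zero)) \<and>
     (\<forall>i\<in>ordinals. cob D (ord_succ i) = Ob F (cob D i)) \<and>
     (\<forall>i\<in>ordinals. \<forall>j\<in>ordinals. ord_le i j \<longrightarrow>
        cmap D (ord_succ j) (ord_succ i) = Ar F (cob D j) (cob D i) (cmap D j i)) \<and>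
     (\<forall>j. limit_ordinal j \<longrightarrow> is_limit_cone (elts j) D (cob D j) (cmap D j))"


subsection \<open>Right Kan extensions of ordinal-indexed chains\<close>

text \<open>The equation \<open>\<epsilon> \<circ> \<gamma>D = \<alpha>\<close>, for \<open>\<gamma>\<close> a transformation out of \<open>F\<close>.\<close>

definition factors_as ::
    "'v::zfc_universe chain \<Rightarrow> 'v set_functor \<Rightarrow> ('v \<Rightarrow> 'v \<Rightarrow> 'v) \<Rightarrow> ('v \<Rightarrow> 'v \<Rightarrow> 'v) \<Rightarrow> ('v \<Rightarrow> 'v \<Rightarrow> 'v) \<Rightarrow> bool" where
  "factors_as D F \<alpha> \<epsilon> \<gamma> \<longleftrightarrow>
     (\<forall>i\<in>ordinals. compose (elts (Ob F (cob D i))) (\<epsilon> i) (\<gamma> (cob D i)) = \<alpha> i)"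

definition is_right_Kan_extension ::
    "'v::zfc_universe chain \<Rightarrow> 'v chain \<Rightarrow> 'v set_functor \<Rightarrow> ('v \<Rightarrow> 'v \<Rightarrow> 'v) \<Rightarrow> bool" where
  "is_right_Kan_extension D E R \<epsilon> \<longleftrightarrow>
     is_functor R \<and>
     is_chain_trans ordinals (map_chain R D) E \<epsilon> \<and>
     (\<forall>H \<alpha>. is_functor H \<and> is_chain_trans ordinals (map_chain H D) E \<alpha> \<longrightarrow>
        (\<exists>!\<gamma>. is_nat_trans H R \<gamma> \<and> factors_as D H \<alpha> \<epsilon> \<gamma>))"


subsection \<open>Causal functions\<close>

definition causal :: "'v::zfc_universe chain \<Rightarrow> 'v chain \<Rightarrow> 'v \<Rightarrow> 'v \<Rightarrow> bool" where
  "causal D E X \<alpha> \<longleftrightarrow>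
     \<alpha> \<in> elts (vexp (cob E ord_omega) (vexp (cob D ord_omega) X)) \<and>
     (\<forall>h\<in>elts (vexp (cob D ord_omega) X). \<forall>k\<in>elts (vexp (cob D ord_omega) X). \<forall>i\<in>elts ord_omega.
        compose (elts X) (cmap D ord_omega i) (vfun X h) = compose (elts X) (cmap D ord_omega i) (vfun X k) \<longrightarrow>
        cmap E ord_omega i (vapp \<alpha> h) = cmap E ord_omega i (vapp \<alpha> k))"

definition causal_obj :: "'v::zfc_universe chain \<Rightarrow> 'v chain \<Rightarrow> 'v \<Rightarrow> 'v" where
  "causal_obj D E X = vset {\<alpha>. causal D E X \<alpha>}"

definition causal_functor :: "'v::zfc_universe chain \<Rightarrow> 'v chain \<Rightarrow> 'v set_functor" where
  "causal_functor D E =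
     \<lparr>Ob = causal_obj D E,
      Ar = (\<lambda>X Y h. \<lambda>\<alpha>\<in>elts (causal_obj D E X).
              vlambda (vexp (cob D ord_omega) Y)
                (\<lambda>f. vapp \<alpha> (vlambda X (compose (elts X) (vfun Y f) h))))\<rparr>"

definition causal_transpose ::
    "'v::zfc_universe chain \<Rightarrow> 'v set_functor \<Rightarrow> ('v \<Rightarrow> 'v \<Rightarrow> 'v) \<Rightarrow> 'v \<Rightarrow> 'v \<Rightarrow> 'v" where
  "causal_transpose D F \<alpha> X =
     (\<lambda>S\<in>elts (Ob F X). vlambda (vexp (cob D ord_omega) X)
        (\<lambda>f. \<alpha> ord_omega (Ar F X (cob D ord_omega) (vfun X f) S)))"


subsection \<open>The sets named by \<open>vset\<close> above exist\<close>

lemma elts_vset: "X \<in> range elts \<Longrightarrow> elts (vset X) = X"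
proof -
  assume "X \<in> range elts"
  then obtain a where a: "elts a = X" by blast
  have "vset X = a"
    unfolding vset_def by (rule the_equality) (simp_all add: a extensionality)
  then show ?thesis by (simp add: a)
qed

lemma in_range_elts_image:
  fixes f :: "'v::zfc_universe \<Rightarrow> 'v"
  shows "X \<in> range elts \<Longrightarrow> f ` X \<in> range elts"
  by (erule imageE) (simp add: replacement)

lemma in_range_elts_subset: "Y \<in> range elts \<Longrightarrow> X \<subseteq> Y \<Longrightarrow> X \<in> range elts"
  by (erule imageE) (simp add: separation)

lemma in_range_elts_empty: "{} \<in> range elts"
  using separation[of "{}"] by simp

lemma in_range_elts_pair: "{a, b::'v::zfc_universe} \<in> range elts"
proof -
  obtain z :: 'v where z: "elts z = {}" using in_range_elts_empty by (metis imageE)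
  have p: "{x::'v. elts x \<subseteq> elts z} = {z}" using z by (auto intro: extensionality[of _ z])
  obtain o1 :: 'v where o1: "elts o1 = {z}" using powerset[of z] p by (metis imageE)
  have zo: "z \<noteq> o1" using z o1 by auto
  have "{z, o1} \<subseteq> {x. elts x \<subseteq> elts o1}" using z o1 by auto
  then have s: "{z, o1} \<in> range elts" by (rule in_range_elts_subset[OF powerset])
  have "(\<lambda>x. if x = z then a else b) ` {z, o1} = {a, b}" using zo by auto
  then show ?thesis using in_range_elts_image[OF s] by metis
qed

lemma in_range_elts_singleton: "{a::'v::zfc_universe} \<in> range elts"
  using in_range_elts_pair[of a a] by simp

lemma in_range_elts_Un:
  assumes "X \<in> range elts" "Y \<in> range elts" shows "X \<union> Y \<in> range elts"
proof -
  obtain x y where xy: "X = elts x" "Y = elts y" using assms by blast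
  have "(\<Union>u\<in>elts (vset {x, y}). elts u) = X \<union> Y"
    by (simp add: elts_vset in_range_elts_pair xy)
  then show ?thesis using union by metis
qed

lemma elts_ord_zero: "elts ord_zero = {}"
  by (simp add: ord_zero_def elts_vset in_range_elts_empty)

lemma elts_ord_succ: "elts (ord_succ i) = insert i (elts i)"
  using in_range_elts_Un[OF in_range_elts_singleton[of i], of "elts i"]
  by (simp add: ord_succ_def elts_vset)

lemma elts_ord_omega: "elts (ord_omega :: 'v::zfc_universe) = range ord_of_nat"
proof -
  obtain a :: 'v where a: "\<exists>z\<in>elts a. elts z = {}"
      "\<forall>x\<in>elts a. \<exists>y\<in>elts a. elts y = insert x (elts x)"
    using infinity by blast
  have "ord_of_nat n \<in> elts a" for n
  proof (induction n)
    case 0 then show ?case using a(1) elts_ord_zero extensionality by (metis ord_of_nat.simps(1))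
  next
    case (Suc n) then show ?case using a(2) elts_ord_succ extensionality by (metis ord_of_nat.simps(2))
  qed
  then have "range ord_of_nat \<subseteq> elts a" by auto
  from separation[OF this] show ?thesis by (simp add: ord_omega_def elts_vset)
qed

lemma vpair_inject: "vpair a b = vpair c d \<longleftrightarrow> a = c \<and> b = d"
proof
  assume eq: "vpair a b = vpair c d"
  have e2: "elts (vset {x, y}) = {x, y}" for x y :: 'a
    by (rule elts_vset[OF in_range_elts_pair])
  have e1: "elts (vset {x}) = {x}" for x :: 'a
    by (rule elts_vset[OF in_range_elts_singleton])
  have "{vset {a}, vset {a, b}} = {vset {c}, vset {c, d}}"
    using arg_cong[OF eq, of elts] unfolding vpair_def e2 .
  then have "elts ` {vset {a}, vset {a, b}} = elts ` {vset {c}, vset {c, d}}" by (rule arg_cong)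
  then have "{{a}, {a, b}} = {{c}, {c, d}}" by (simp only: image_insert image_empty e1 e2)
  then show "a = c \<and> b = d" by (auto simp: doubleton_eq_iff)
qed simp

lemma elts_vlambda: "elts (vlambda X f) = (\<lambda>x. vpair x (f x)) ` elts X"
  by (simp add: vlambda_def elts_vset in_range_elts_image)

lemma vapp_vlambda: "x \<in> elts X \<Longrightarrow> vapp (vlambda X f) x = f x"
  unfolding vapp_def by (rule the_equality) (auto simp: elts_vlambda vpair_inject)

lemma elts_vexp: "elts (vexp Y X) = vlambda X ` hom X Y"
proof -
  have prod: "(\<Union>x\<in>elts X. (\<lambda>y. vpair x y) ` elts Y) \<in> range elts"
  proof -
    have "(\<Union>u\<in>elts (vset ((\<lambda>x. vset ((\<lambda>y. vpair x y) ` elts Y)) ` elts X)). elts u) =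
          (\<Union>x\<in>elts X. (\<lambda>y. vpair x y) ` elts Y)"
      by (simp add: elts_vset in_range_elts_image)
    then show ?thesis using union by metis
  qed
  then obtain P where P: "elts P = (\<Union>x\<in>elts X. (\<lambda>y. vpair x y) ` elts Y)" by (metis imageE)
  have "vlambda X ` hom X Y \<subseteq> {u. elts u \<subseteq> elts P}"
    by (fastforce simp: elts_vlambda P hom_def dest: PiE_mem)
  then have "vlambda X ` hom X Y \<in> range elts" by (rule in_range_elts_subset[OF powerset])
  then show ?thesis by (simp add: vexp_def elts_vset)
qed

lemma elts_causal_obj: "elts (causal_obj D E X) = {\<alpha>. causal D E X \<alpha>}"
proof -
  have "{\<alpha>. causal D E X \<alpha>} \<subseteq> elts (vexp (cob E ord_omega) (vexp (cob D ord_omega) X))"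
    by (auto simp: causal_def)
  from separation[OF this] show ?thesis by (simp add: causal_obj_def elts_vset)
qed

end

theory Submission
  imports Defs
begin

text \<open>
  Since \<open>B\<close> is \<open>\<omega>\<close>-continuous, the maps \<open>B\<^bsub>i,\<omega>\<^esub>\<close> with \<open>i \<ge> \<omega>\<close> are bijections. Moreover
  \<open>A\<^bsub>\<omega>,i\<^esub>\<close> is surjective for \<open>0 < i < \<omega>\<close>: either \<open>A\<^sub>1\<close> is nonempty and all connecting maps below
  \<open>\<omega>\<close> are split epi, or all \<open>A\<^sub>i\<close> with \<open>i > 0\<close> are empty. The counit at \<open>i\<close> sends a causal \<open>\<alpha>\<close> to the
  only \<open>b \<in> B\<^sub>i\<close> such that \<open>B\<^bsub>i,j\<^esub> b = B\<^bsub>\<omega>,j\<^esub> (\<alpha> s)\<close> for all \<open>j \<le> i\<close>, \<open>j \<le> \<omega>\<close> and all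
  \<open>s : A\<^sub>i \<rightarrow> A\<^sub>\<omega>\<close> with \<open>A\<^bsub>\<omega>,j\<^esub> \<circ> s = A\<^bsub>i,j\<^esub>\<close>. By causality any one \<open>s\<close> lifting \<open>A\<^bsub>i,j\<^esub>\<close> for the
  largest \<open>j\<close> decides \<open>b\<close>: \<open>A\<^bsub>i,\<omega>\<^esub>\<close> if \<open>i \<ge> \<omega>\<close>, a section of \<open>A\<^bsub>\<omega>,i\<^esub>\<close> if \<open>0 < i < \<omega>\<close>; at \<open>i = 0\<close>
  the set \<open>B\<^sub>0\<close> is a singleton. This description makes naturality of the counit and the factorisation
  of the transpose immediate, and uniqueness of the transpose is the Yoneda argument at \<open>id\<close> on
  \<open>A\<^sub>\<omega>\<close>.
\<close>

section \<open>Morphisms and exponentials\<close>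

lemma hom_app: "f \<in> hom X Y \<Longrightarrow> x \<in> elts X \<Longrightarrow> f x \<in> elts Y"
  by (auto simp: hom_def)

lemma hom_ext: "f \<in> hom X Y \<Longrightarrow> g \<in> hom X Z \<Longrightarrow> (\<And>x. x \<in> elts X \<Longrightarrow> f x = g x) \<Longrightarrow> f = g"
  unfolding hom_def PiE_def by (auto intro: extensionalityI)

lemma idm_hom: "idm X \<in> hom X X"
  by (auto simp: hom_def idm_def)

lemma compose_hom: "f \<in> hom X Y \<Longrightarrow> g \<in> hom Y Z \<Longrightarrow> compose (elts X) g f \<in> hom X Z"
  by (auto simp: hom_def compose_def)

lemma compose_idm_right: "f \<in> hom X Y \<Longrightarrow> compose (elts X) f (idm X) = f"
  by (auto simp: hom_def idm_def compose_def restrict_def PiE_def extensional_def)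

lemma compose_idm_left: "f \<in> hom X Y \<Longrightarrow> compose (elts X) (idm Y) f = f"
  by (rule hom_ext[OF compose_hom[OF _ idm_hom]]) (auto simp: hom_app idm_def compose_def)

lemma compose_assoc_hom:
  "f \<in> hom X Y \<Longrightarrow> compose (elts X) h (compose (elts X) g f) = compose (elts X) (compose (elts Y) h g) f"
  by (auto simp: compose_def hom_app intro!: restrict_ext)

section \<open>Graphs as elements of exponentials\<close>

lemma vlambda_cong: "(\<And>x. x \<in> elts X \<Longrightarrow> f x = g x) \<Longrightarrow> vlambda X f = vlambda X g"
  unfolding vlambda_def by (metis (mono_tags, lifting) image_cong)

lemma vfun_vlambda: "f \<in> hom X Y \<Longrightarrow> vfun X (vlambda X f) = f"
  by (auto simp: vfun_def vapp_vlambda hom_def PiE_def extensional_def)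

lemma vlambda_in_vexp: "f \<in> hom X Y \<Longrightarrow> vlambda X f \<in> elts (vexp Y X)"
  by (simp add: elts_vexp)

text \<open>A graph records values on \<open>X\<close> only, so this serves functions that are not
  extensional and hence not in \<open>hom X Y\<close>.\<close>

lemma vlambda_in_vexp': "(\<And>x. x \<in> elts X \<Longrightarrow> f x \<in> elts Y) \<Longrightarrow> vlambda X f \<in> elts (vexp Y X)"
proof -
  assume f: "\<And>x. x \<in> elts X \<Longrightarrow> f x \<in> elts Y"
  have "vlambda X f = vlambda X (restrict f (elts X))" by (rule vlambda_cong) simp
  moreover have "restrict f (elts X) \<in> hom X Y" using f by (auto simp: hom_def)
  ultimately show ?thesis by (metis vlambda_in_vexp)
qed

lemma vexpE:
  assumes "g \<in> elts (vexp Y X)"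
  obtains f where "f \<in> hom X Y" "g = vlambda X f"
  using assms by (auto simp: elts_vexp)

lemma vexp_app: "g \<in> elts (vexp Y X) \<Longrightarrow> x \<in> elts X \<Longrightarrow> vapp g x \<in> elts Y"
  by (auto simp: elts_vexp vapp_vlambda hom_app)

lemma vexp_ext:
  assumes "g \<in> elts (vexp Y X)" "h \<in> elts (vexp Z X)" "\<And>x. x \<in> elts X \<Longrightarrow> vapp g x = vapp h x"
  shows "g = h"
proof -
  obtain f k where "g = vlambda X f" "h = vlambda X k" using assms(1,2) by (auto simp: elts_vexp)
  then show ?thesis using assms(3) by (auto intro!: vlambda_cong simp: vapp_vlambda)
qed

section \<open>Functors on elements, surjections and bijections\<close>

lemma functor_hom: "is_functor F \<Longrightarrow> f \<in> hom X Y \<Longrightarrow> Ar F X Y f \<in> hom (Ob F X) (Ob F Y)"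
  by (simp add: is_functor_def)

lemma functor_app: "is_functor F \<Longrightarrow> f \<in> hom X Y \<Longrightarrow> x \<in> elts (Ob F X) \<Longrightarrow> Ar F X Y f x \<in> elts (Ob F Y)"
  by (rule hom_app[OF functor_hom])

lemma functor_id: "is_functor F \<Longrightarrow> x \<in> elts (Ob F X) \<Longrightarrow> Ar F X X (idm X) x = x"
  by (simp add: is_functor_def idm_def)

lemma functor_comp:
  "is_functor F \<Longrightarrow> f \<in> hom X Y \<Longrightarrow> g \<in> hom Y Z \<Longrightarrow> x \<in> elts (Ob F X) \<Longrightarrow>
    Ar F X Z (compose (elts X) g f) x = Ar F Y Z g (Ar F X Y f x)"
  by (simp add: is_functor_def compose_def)

lemma hom_section:
  assumes "p \<in> hom X Y" "elts Y \<subseteq> p ` elts X"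
  obtains s where "s \<in> hom Y X" "compose (elts Y) p s = idm Y"
proof
  let ?s = "\<lambda>y\<in>elts Y. inv_into (elts X) p y"
  show "?s \<in> hom Y X" using assms(2) by (auto simp: hom_def inv_into_into)
  show "compose (elts Y) p ?s = idm Y"
    using assms(2) by (auto simp: compose_def idm_def f_inv_into_f intro!: restrict_ext)
qed

text \<open>By choice the surjection has a section, and \<open>F\<close> maps that section to a
  section of \<open>Ar F X Y p\<close>.\<close>

lemma functor_surj:
  assumes F: "is_functor F" and p: "p \<in> hom X Y" and surj: "elts Y \<subseteq> p ` elts X"
  shows "elts (Ob F Y) \<subseteq> Ar F X Y p ` elts (Ob F X)"
proof
  fix y assume y: "y \<in> elts (Ob F Y)"
  obtain s where s: "s \<in> hom Y X" "compose (elts Y) p s = idm Y" using hom_section[OF p surj] .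
  have "y = Ar F X Y p (Ar F Y X s y)"
    using functor_comp[OF F s(1) p y] s(2) functor_id[OF F y] by simp
  then show "y \<in> Ar F X Y p ` elts (Ob F X)" using functor_app[OF F s(1) y] by blast
qed

text \<open>The section is also a left inverse of \<open>p\<close>; applying \<open>F\<close> to
  that equation gives injectivity.\<close>

lemma functor_bij:
  assumes F: "is_functor F" and p: "p \<in> hom X Y" and bij: "bij_betw p (elts X) (elts Y)"
  shows "bij_betw (Ar F X Y p) (elts (Ob F X)) (elts (Ob F Y))"
proof -
  have surj: "elts Y \<subseteq> p ` elts X" using bij by (simp add: bij_betw_def)
  obtain s where s: "s \<in> hom Y X" "compose (elts Y) p s = idm Y" using hom_section[OF p surj] .
  have sp: "compose (elts X) s p = idm X"
  proof (rule hom_ext[OF compose_hom[OF p s(1)] idm_hom])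
    fix x assume x: "x \<in> elts X"
    have "p (s (p x)) = p x"
      using fun_cong[OF s(2), of "p x"] hom_app[OF p x] by (simp add: compose_def idm_def)
    then have "s (p x) = x"
      using bij x hom_app[OF s(1) hom_app[OF p x]] by (auto simp: bij_betw_def inj_on_def)
    then show "compose (elts X) s p x = idm X x" using x by (simp add: compose_def idm_def)
  qed
  have "inj_on (Ar F X Y p) (elts (Ob F X))"
    by (rule inj_on_inverseI[where g = "Ar F Y X s"])
      (use functor_comp[OF F p s(1)] sp functor_id[OF F] in simp)
  then show ?thesis
    using functor_surj[OF F p surj] functor_app[OF F p] by (auto simp: bij_betw_def)
qed

section \<open>Ordinals\<close>

lemma elts_irrefl: "x \<notin> elts (x::'v::zfc_universe)"
  using wf_not_refl[OF foundation, of x] by simp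

lemma ordinal_elt: "ordinal j \<Longrightarrow> i \<in> elts j \<Longrightarrow> ordinal i"
  unfolding ordinal_def by (meson subsetD)

lemma ordinal_elt_le: "ordinal j \<Longrightarrow> i \<in> elts j \<Longrightarrow> ord_le i j"
  by (auto simp: ordinal_def ord_le_def)

text \<open>Nested membership induction, first on \<open>i\<close> and then on \<open>j\<close>: two
  incomparable ordinals all of whose elements are comparable would have the same elements.\<close>

lemma ordinal_trichotomy:
  fixes i j :: "'v::zfc_universe"
  assumes "ordinal i" "ordinal j"
  shows "i \<in> elts j \<or> i = j \<or> j \<in> elts i"
  using assms
proof (induction i arbitrary: j rule: wf_induct_rule[OF foundation])
  case (1 i)
  note IH_i = "1.IH" and oi = "1.prems"(1)
  from "1.prems"(2) show ?case
  proof (induction j rule: wf_induct_rule[OF foundation])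
    case (1 j)
    note IH_j = "1.IH" and oj = "1.prems"
    show ?case
    proof (rule ccontr)
      assume neg: "\<not> ?case"
      \<comment> \<open>If \<open>y\<close> were not in \<open>i\<close>, the induction hypothesis
        would give \<open>i = y\<close> or \<open>i\<close> in \<open>y\<close>, and transitivity of
        \<open>j\<close> would put \<open>i\<close> in \<open>j\<close>. The other inclusion is
        symmetric.\<close>
      have "y \<in> elts i" if "y \<in> elts j" for y
        using that neg IH_j[of y] ordinal_elt[OF oj that] oj by (auto simp: ordinal_def)
      moreover have "x \<in> elts j" if "x \<in> elts i" for x
        using that neg IH_i[of x j] ordinal_elt[OF oi that] oi oj by (auto simp: ordinal_def)
      ultimately have "i = j" by (blast intro: extensionality)
      with neg show False by blast
    qed
  qed
qed

lemma ordinal_cases_le: "ordinal i \<Longrightarrow> ordinal j \<Longrightarrow> i \<in> elts j \<or> ord_le j i"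
  using ordinal_trichotomy[of i j] ordinal_elt_le[of i j] by (auto simp: ord_le_def ordinal_def)

lemma ord_le_refl: "ord_le i i"
  by (simp add: ord_le_def)

lemma ord_le_trans: "ord_le i j \<Longrightarrow> ord_le j k \<Longrightarrow> ord_le i k"
  by (auto simp: ord_le_def)

lemma ord_le_antisym: "ord_le i j \<Longrightarrow> ord_le j i \<Longrightarrow> i = j"
  by (auto simp: ord_le_def intro: extensionality)

lemma ordinal_zero: "ordinal ord_zero"
  by (simp add: ordinal_def elts_ord_zero)

lemma ord_zero_le: "ord_le ord_zero i"
  by (simp add: ord_le_def elts_ord_zero)

lemma ordinal_succ: "ordinal i \<Longrightarrow> ordinal (ord_succ i)"
  by (auto simp: ordinal_def elts_ord_succ)

lemma ord_le_succ: "ord_le i (ord_succ i)"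
  by (auto simp: ord_le_def elts_ord_succ)

text \<open>Inclusion between ordinals means membership or equality: the remaining case of
  trichotomy would put \<open>j\<close> in itself.\<close>

lemma ord_succ_mono: "ordinal i \<Longrightarrow> ordinal j \<Longrightarrow> ord_le i j \<Longrightarrow> ord_le (ord_succ i) (ord_succ j)"
  using ordinal_trichotomy[of i j] elts_irrefl[of j]
  by (auto simp: ord_le_def elts_ord_succ)

section \<open>Finite ordinals and \<omega>\<close>

lemma ordinal_of_nat: "ordinal (ord_of_nat n)"
  by (induction n) (simp_all add: ordinal_zero ordinal_succ)

lemma ord_of_nat_mono: "m \<le> n \<Longrightarrow> ord_le (ord_of_nat m) (ord_of_nat n)"
  by (induction n) (auto simp: le_Suc_eq ord_le_refl intro: ord_le_trans ord_le_succ)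

lemma ord_of_nat_le_iff: "ord_le (ord_of_nat m) (ord_of_nat n :: 'v::zfc_universe) \<longleftrightarrow> m \<le> n"
proof
  assume le: "ord_le (ord_of_nat m) (ord_of_nat n :: 'v)"
  show "m \<le> n"
  proof (rule ccontr)
    assume "\<not> m \<le> n"
    then have "ord_le (ord_of_nat (Suc n)) (ord_of_nat m :: 'v)" by (intro ord_of_nat_mono) simp
    then have "ord_of_nat n \<in> elts (ord_of_nat n :: 'v)"
      using le by (auto simp: ord_le_def elts_ord_succ)
    then show False using elts_irrefl by blast
  qed
qed (rule ord_of_nat_mono)

lemma ord_of_nat_in_omega: "ord_of_nat n \<in> elts ord_omega"
  by (simp add: elts_ord_omega)

lemma ordinal_omega: "ordinal (ord_omega :: 'v::zfc_universe)"
proof -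
  have "elts (ord_of_nat n :: 'v) \<subseteq> range ord_of_nat" for n
    by (induction n) (auto simp: elts_ord_zero elts_ord_succ)
  moreover have "\<forall>y\<in>elts (ord_of_nat n :: 'v). elts y \<subseteq> elts (ord_of_nat n)" for n
    using ordinal_of_nat[of n, where 'a = 'v] by (simp add: ordinal_def)
  ultimately show ?thesis by (auto simp: ordinal_def elts_ord_omega)
qed

lemma ord_of_nat_le_omega: "ord_le (ord_of_nat n) ord_omega"
  by (rule ordinal_elt_le[OF ordinal_omega ord_of_nat_in_omega])

lemma succ_in_omega: "i \<in> elts ord_omega \<Longrightarrow> ord_succ i \<in> elts ord_omega"
  by (auto simp: elts_ord_omega simp del: ord_of_nat.simps simp: ord_of_nat.simps(2)[symmetric])

lemma limit_ordinal_omega: "limit_ordinal (ord_omega :: 'v::zfc_universe)"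
proof -
  have "ord_omega \<noteq> (ord_succ i :: 'v)" for i
  proof
    assume eq: "ord_omega = (ord_succ i :: 'v)"
    then have "i \<in> elts ord_omega" by (metis elts_ord_succ insertI1)
    then have "ord_succ i \<in> elts (ord_succ i)" using succ_in_omega eq by metis
    then show False using elts_irrefl by blast
  qed
  moreover have "ord_omega \<noteq> (ord_zero :: 'v)"
    using ord_of_nat_in_omega[of 0] by (metis elts_ord_zero empty_iff)
  ultimately show ?thesis by (simp add: limit_ordinal_def ordinal_omega)
qed

text \<open>Base, successor and limit step of an induction that starts at \<omega>. The limit case
  is strictly above \<omega>, so \<omega> is itself one of the stages over which the limit is
  taken.\<close>

lemma ordinal_above_omega_cases:
  fixes i :: "'v::zfc_universe"
  assumes "ordinal i" "ord_le ord_omega i"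
  obtains "i = ord_omega"
  | k where "ordinal k" "ord_le ord_omega k" "k \<in> elts i" "i = ord_succ k"
  | "limit_ordinal i" "ord_omega \<in> elts i"
proof (cases "i = ord_omega")
  case False
  then have mem: "ord_omega \<in> elts i"
    using ordinal_trichotomy[OF assms(1) ordinal_omega] assms(2) elts_irrefl
    by (auto simp: ord_le_def)
  show thesis
  proof (cases "limit_ordinal i")
    case True then show ?thesis using that mem by blast
  next
    case False
    then obtain k where k: "ordinal k" "i = ord_succ k"
      using assms(1) mem by (auto simp: limit_ordinal_def elts_ord_zero)
    then have "ord_le ord_omega k"
      using mem ordinal_elt_le[OF k(1)] by (auto simp: elts_ord_succ ord_le_refl)
    with k that show ?thesis by (auto simp: elts_ord_succ)
  qed
qed (rule that)

section \<open>Chains and limits\<close>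

lemma chain_hom:
  "is_chain ordinals D \<Longrightarrow> ordinal i \<Longrightarrow> ordinal j \<Longrightarrow> ord_le i j \<Longrightarrow> cmap D j i \<in> hom (cob D j) (cob D i)"
  by (simp add: is_chain_def ordinals_def)

lemma chain_app:
  "is_chain ordinals D \<Longrightarrow> ordinal i \<Longrightarrow> ordinal j \<Longrightarrow> ord_le i j \<Longrightarrow> x \<in> elts (cob D j) \<Longrightarrow>
    cmap D j i x \<in> elts (cob D i)"
  by (rule hom_app[OF chain_hom])

lemma chain_id: "is_chain ordinals D \<Longrightarrow> ordinal i \<Longrightarrow> cmap D i i = idm (cob D i)"
  by (simp add: is_chain_def ordinals_def)

lemma chain_id_app:
  "is_chain ordinals D \<Longrightarrow> ordinal i \<Longrightarrow> x \<in> elts (cob D i) \<Longrightarrow> cmap D i i x = x"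
  by (simp add: chain_id idm_def)

lemma chain_comp:
  "is_chain ordinals D \<Longrightarrow> ordinal i \<Longrightarrow> ordinal j \<Longrightarrow> ordinal k \<Longrightarrow> ord_le i j \<Longrightarrow> ord_le j k \<Longrightarrow>
    compose (elts (cob D k)) (cmap D j i) (cmap D k j) = cmap D k i"
  unfolding is_chain_def ordinals_def by (metis mem_Collect_eq)

lemma chain_comp_app:
  "is_chain ordinals D \<Longrightarrow> ordinal i \<Longrightarrow> ordinal j \<Longrightarrow> ordinal k \<Longrightarrow> ord_le i j \<Longrightarrow> ord_le j k \<Longrightarrow>
    x \<in> elts (cob D k) \<Longrightarrow> cmap D j i (cmap D k j x) = cmap D k i x"
  using chain_comp[of D i j k] by (metis compose_eq)

lemma is_chain_subset: "is_chain I D \<Longrightarrow> J \<subseteq> I \<Longrightarrow> is_chain J D"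
  unfolding is_chain_def by (meson subsetD)

text \<open>Elements of \<open>L\<close> are maps from a one-point set, so two elements with equal
  projections are two mediating maps for the same cone.\<close>

lemma limit_cone_inj:
  assumes L: "is_limit_cone I D L p" and x: "x \<in> elts L" and y: "y \<in> elts L"
    and eq: "\<And>i. i \<in> I \<Longrightarrow> p i x = p i y"
  shows "x = y"
proof -
  let ?Z = "vset {x}"
  have Z: "elts ?Z = {x}" by (rule elts_vset[OF in_range_elts_singleton])
  define q where "q i = (\<lambda>z\<in>elts ?Z. p i x)" for i
  have ph: "p i \<in> hom L (cob D i)" if "i \<in> I" for i
    using L that by (simp add: is_limit_cone_def is_cone_def)
  have "is_cone I D ?Z q"
    unfolding is_cone_def
  proof (intro conjI ballI impI)
    fix i assume "i \<in> I"
    then show "q i \<in> hom ?Z (cob D i)" using hom_app[OF ph x] by (auto simp: q_def hom_def)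
  next
    fix i j assume ij: "i \<in> I" "j \<in> I" "ord_le i j"
    then have "compose (elts L) (cmap D j i) (p j) = p i"
      using L by (simp add: is_limit_cone_def is_cone_def)
    then have "cmap D j i (p j x) = p i x" using x by (metis compose_eq)
    then show "compose (elts ?Z) (cmap D j i) (q j) = q i" by (auto simp: compose_def q_def)
  qed
  then have "\<exists>!u. u \<in> hom ?Z L \<and> (\<forall>i\<in>I. compose (elts ?Z) (p i) u = q i)"
    using L by (simp add: is_limit_cone_def)
  moreover have "(\<lambda>z\<in>elts ?Z. w) \<in> hom ?Z L \<and> (\<forall>i\<in>I. compose (elts ?Z) (p i) (\<lambda>z\<in>elts ?Z. w) = q i)"
    if "w = x \<or> w = y" for w
    using that x y eq by (auto simp: hom_def compose_def q_def)
  ultimately have "(\<lambda>z\<in>elts ?Z. x) = (\<lambda>z\<in>elts ?Z. y)" by blast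
  from fun_cong[OF this, of x] show ?thesis by (simp add: Z)
qed

text \<open>A compatible family is a cone with a one-point apex, and the mediating map picks the
  element. Together with \<open>limit_cone_inj\<close> this identifies limits in Set with sets of
  compatible families.\<close>

lemma limit_cone_surj:
  fixes D :: "'v::zfc_universe chain"
  assumes L: "is_limit_cone I D L p"
    and b: "\<And>i. i \<in> I \<Longrightarrow> b i \<in> elts (cob D i)"
    and compat: "\<And>i j. i \<in> I \<Longrightarrow> j \<in> I \<Longrightarrow> ord_le i j \<Longrightarrow> cmap D j i (b j) = b i"
  obtains x where "x \<in> elts L" "\<And>i. i \<in> I \<Longrightarrow> p i x = b i"
proof -
  let ?Z = "vset {ord_zero :: 'v}"
  have Z: "elts ?Z = {ord_zero}" by (rule elts_vset[OF in_range_elts_singleton])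
  define q where "q i = (\<lambda>z\<in>elts ?Z. b i)" for i
  have "is_cone I D ?Z q"
    using b compat by (auto simp: is_cone_def q_def hom_def compose_def intro!: restrict_ext)
  then obtain u where u: "u \<in> hom ?Z L" "\<forall>i\<in>I. compose (elts ?Z) (p i) u = q i"
    using L unfolding is_limit_cone_def by blast
  show thesis
  proof
    show "u ord_zero \<in> elts L" using hom_app[OF u(1)] Z by simp
    fix i assume "i \<in> I"
    then have "compose (elts ?Z) (p i) u ord_zero = q i ord_zero" using u(2) by simp
    then show "p i (u ord_zero) = b i" by (simp add: compose_def q_def Z)
  qed
qed

section \<open>Final sequences\<close>

context
  fixes F :: "'v::zfc_universe set_functor" and D :: "'v chain"
  assumes F: "is_functor F" and D: "is_final_sequence F D"
begin

lemma final_sequence_chain: "is_chain ordinals D"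
  using D by (simp add: is_final_sequence_def)

lemma final_sequence_zero: "is_singleton (elts (cob D ord_zero))"
  using D by (simp add: is_final_sequence_def)

lemma final_sequence_succ: "ordinal i \<Longrightarrow> cob D (ord_succ i) = Ob F (cob D i)"
  using D by (simp add: is_final_sequence_def ordinals_def)

lemma final_sequence_succ_map:
  "ordinal i \<Longrightarrow> ordinal j \<Longrightarrow> ord_le i j \<Longrightarrow>
    cmap D (ord_succ j) (ord_succ i) = Ar F (cob D j) (cob D i) (cmap D j i)"
  using D by (simp add: is_final_sequence_def ordinals_def)

lemma final_sequence_limit: "limit_ordinal j \<Longrightarrow> is_limit_cone (elts j) D (cob D j) (cmap D j)"
  using D by (simp add: is_final_sequence_def)

lemmas fs_app = chain_app[OF final_sequence_chain]
  and fs_hom = chain_hom[OF final_sequence_chain]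
  and fs_comp = chain_comp_app[OF final_sequence_chain]
  and fs_id = chain_id_app[OF final_sequence_chain]

section \<open>Surjectivity of the projections from \<omega> to the positive finite stages\<close>

lemma final_sequence_surj_step:
  assumes ne: "elts (cob D (ord_of_nat 1)) \<noteq> {}"
  shows "elts (cob D (ord_of_nat n)) \<subseteq> cmap D (ord_of_nat (Suc n)) (ord_of_nat n) ` elts (cob D (ord_of_nat (Suc n)))"
proof (induction n)
  case 0
  obtain x where x: "x \<in> elts (cob D (ord_of_nat 1))" using ne by blast
  have "cmap D (ord_of_nat 1) ord_zero x \<in> elts (cob D ord_zero)"
    using fs_app[OF ordinal_zero ordinal_of_nat ord_zero_le x] .
  then show ?case
    using final_sequence_zero x by (auto simp: is_singleton_def)
next
  case (Suc n)
  have le: "ord_le (ord_of_nat n) (ord_of_nat (Suc n) :: 'v)" by (rule ord_of_nat_mono) simp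
  \<comment> \<open>The connecting map one stage up is \<open>F\<close> applied to this one, and
    \<open>F\<close> preserves surjections.\<close>
  show ?case
    using functor_surj[OF F fs_hom[OF ordinal_of_nat ordinal_of_nat le] Suc]
    by (simp add: final_sequence_succ final_sequence_succ_map ordinal_of_nat ordinal_succ ord_le_succ)
qed

text \<open>A point of stage \<open>n\<close> is lifted one stage at a time, and the resulting
  thread is a point of the limit. For \<open>n = 0\<close> this can fail: stage 0 is a singleton
  even when all later stages are empty.\<close>

lemma final_sequence_omega_surj:
  assumes "0 < n"
  shows "elts (cob D (ord_of_nat n)) \<subseteq> cmap D ord_omega (ord_of_nat n) ` elts (cob D ord_omega)"
proof
  let ?o = "ord_of_nat :: nat \<Rightarrow> 'v"
  fix x assume x: "x \<in> elts (cob D (?o n))"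
  \<comment> \<open>As \<open>n\<close> is positive, \<open>x\<close> has an image in stage 1, which
    is therefore inhabited.\<close>
  have "elts (cob D (?o 1)) \<noteq> {}"
    using fs_app[OF ordinal_of_nat ordinal_of_nat ord_of_nat_mono x, of 1] assms by auto
  note step = final_sequence_surj_step[OF this]
  \<comment> \<open>Dependent choice: \<open>f k\<close> lies \<open>k\<close> stages above
    \<open>x\<close>, and each \<open>f (Suc k)\<close> lifts \<open>f k\<close>.\<close>
  have "\<exists>f. \<forall>k. (f k \<in> elts (cob D (?o (n + k))) \<and> (k = 0 \<longrightarrow> f k = x)) \<and>
      cmap D (?o (n + Suc k)) (?o (n + k)) (f (Suc k)) = f k"
  proof (rule dependent_nat_choice)
    show "\<exists>y. y \<in> elts (cob D (?o (n + 0))) \<and> (0 = (0::nat) \<longrightarrow> y = x)" using x by simp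
    fix y and k :: nat
    assume "y \<in> elts (cob D (?o (n + k))) \<and> (k = 0 \<longrightarrow> y = x)"
    then obtain z where "z \<in> elts (cob D (?o (Suc (n + k))))"
      "cmap D (?o (Suc (n + k))) (?o (n + k)) z = y"
      using step[of "n + k"] by (auto simp del: ord_of_nat.simps)
    then show "\<exists>z. (z \<in> elts (cob D (?o (n + Suc k))) \<and> (Suc k = 0 \<longrightarrow> z = x)) \<and>
      cmap D (?o (n + Suc k)) (?o (n + k)) z = y" by (auto simp del: ord_of_nat.simps)
  qed
  then obtain f where f: "\<And>k. f k \<in> elts (cob D (?o (n + k)))" "f 0 = x"
    and f_step: "\<And>k. cmap D (?o (n + Suc k)) (?o (n + k)) (f (Suc k)) = f k" by blast
  have f_le: "cmap D (?o (n + l)) (?o (n + k)) (f l) = f k" if "k \<le> l" for k l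
    using that
  proof (induction l rule: dec_induct)
    case base show ?case by (rule fs_id[OF ordinal_of_nat f(1)])
  next
    case (step l)
    have "cmap D (?o (n + Suc l)) (?o (n + k)) (f (Suc l)) =
        cmap D (?o (n + l)) (?o (n + k)) (cmap D (?o (n + Suc l)) (?o (n + l)) (f (Suc l)))"
      using step.hyps
      by (intro fs_comp[symmetric] ordinal_of_nat ord_of_nat_mono f(1)) auto
    then show ?case using step.IH f_step by (simp del: ord_of_nat.simps)
  qed
  \<comment> \<open>The thread needs a value at every finite stage, also below \<open>n\<close>.
    Pushing \<open>f m\<close> down from stage \<open>n + m\<close> to stage \<open>m\<close> gives
    it uniformly; \<open>inv ?o\<close> recovers \<open>m\<close> from the ordinal.\<close>
  define b where "b i = (let m = inv ?o i in cmap D (?o (n + m)) (?o m) (f m))" for i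
  have "inj ?o"
    by (rule injI) (metis ord_of_nat_le_iff order_refl order_antisym)
  then have b: "b (?o m) = cmap D (?o (n + m)) (?o m) (f m)" for m
    by (simp add: b_def)
  have b_mem: "b i \<in> elts (cob D i)" if i: "i \<in> elts ord_omega" for i
  proof -
    obtain m where m: "i = ?o m" using i by (auto simp: elts_ord_omega)
    show ?thesis unfolding m b by (intro fs_app ordinal_of_nat ord_of_nat_mono f(1)) simp
  qed
  have b_compat: "cmap D j i (b j) = b i"
    if i: "i \<in> elts ord_omega" and j: "j \<in> elts ord_omega" and le: "ord_le i j" for i j
  proof -
    obtain k l where kl: "i = ?o k" "j = ?o l" using i j by (auto simp: elts_ord_omega)
    then have "k \<le> l" using le ord_of_nat_le_iff by blast
    have "cmap D (?o l) (?o k) (b (?o l)) = cmap D (?o (n + l)) (?o k) (f l)"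
      unfolding b using \<open>k \<le> l\<close> by (intro fs_comp ordinal_of_nat ord_of_nat_mono f(1)) auto
    also have "\<dots> = cmap D (?o (n + k)) (?o k) (cmap D (?o (n + l)) (?o (n + k)) (f l))"
      using \<open>k \<le> l\<close> by (intro fs_comp[symmetric] ordinal_of_nat ord_of_nat_mono f(1)) auto
    also have "\<dots> = b (?o k)" by (simp add: f_le[OF \<open>k \<le> l\<close>] b)
    finally show ?thesis by (simp add: kl)
  qed
  obtain y where y: "y \<in> elts (cob D ord_omega)"
    and yb: "\<And>i. i \<in> elts ord_omega \<Longrightarrow> cmap D ord_omega i y = b i"
    using limit_cone_surj[OF final_sequence_limit[OF limit_ordinal_omega] b_mem b_compat] by blast
  \<comment> \<open>At stage \<open>n\<close> the thread is \<open>f n\<close> pushed down from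
    stage \<open>n + n\<close> to stage \<open>n\<close>, which is \<open>f 0\<close>.\<close>
  have "cmap D ord_omega (?o n) y = x"
    using yb[OF ord_of_nat_in_omega[of n]] f_le[of 0 n] f(2) by (simp add: b)
  then show "x \<in> cmap D ord_omega (?o n) ` elts (cob D ord_omega)" using y by blast
qed

text \<open>Continuity makes stage \<omega>+1 the limit of the finite stages i+1. Dropping the first
  stage of a chain does not change its limit, so the comparison with stage \<omega>, which is the
  connecting map, is bijective.\<close>

lemma final_sequence_omega_succ_bij:
  assumes cont: "omega_continuous F"
  shows "bij_betw (cmap D (ord_succ ord_omega) ord_omega) (elts (cob D (ord_succ ord_omega))) (elts (cob D ord_omega))"
proof -
  let ?w = "ord_omega :: 'v" and ?w' = "ord_succ ord_omega :: 'v"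
  have ow': "ordinal ?w'" by (rule ordinal_succ[OF ordinal_omega])
  have om: "ordinal i" if "i \<in> elts ?w" for i using that by (rule ordinal_elt[OF ordinal_omega])
  have le: "ord_le i ?w" if "i \<in> elts ?w" for i using that by (rule ordinal_elt_le[OF ordinal_omega])
  have "is_chain (elts ?w) D"
    by (rule is_chain_subset[OF final_sequence_chain]) (auto simp: ordinals_def om)
  then have "is_limit_cone (elts ?w) (map_chain F D) (Ob F (cob D ?w))
      (\<lambda>i. Ar F (cob D ?w) (cob D i) (cmap D ?w i))"
    using cont final_sequence_limit[OF limit_ordinal_omega] unfolding omega_continuous_def by blast
  then have lim: "is_limit_cone (elts ?w) (map_chain F D) (cob D ?w')
      (\<lambda>i. Ar F (cob D ?w) (cob D i) (cmap D ?w i))"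
    by (simp add: final_sequence_succ[OF ordinal_omega])
  \<comment> \<open>Each projection of the new limit cone is the connecting map from \<omega>+1 to
    i+1, so it passes through stage \<omega>.\<close>
  have factor: "Ar F (cob D ?w) (cob D i) (cmap D ?w i) x = cmap D ?w (ord_succ i) (cmap D ?w' ?w x)"
    if i: "i \<in> elts ?w" and x: "x \<in> elts (cob D ?w')" for i x
    using fs_comp[OF ordinal_succ[OF om[OF i]] ordinal_omega ow' le[OF succ_in_omega[OF i]] ord_le_succ x]
    by (simp add: final_sequence_succ_map[OF om[OF i] ordinal_omega le[OF i]])
  have inj: "inj_on (cmap D ?w' ?w) (elts (cob D ?w'))"
    by (rule inj_onI, rule limit_cone_inj[OF lim]) (simp_all add: factor)
  moreover have "y \<in> cmap D ?w' ?w ` elts (cob D ?w')" if y: "y \<in> elts (cob D ?w)" for y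
  proof -
    \<comment> \<open>The components of \<open>y\<close> at successor stages form a compatible
      family for the shifted chain.\<close>
    obtain x where x: "x \<in> elts (cob D ?w')"
      and xy: "\<And>i. i \<in> elts ?w \<Longrightarrow> Ar F (cob D ?w) (cob D i) (cmap D ?w i) x = cmap D ?w (ord_succ i) y"
    proof (rule limit_cone_surj[OF lim, where b = "\<lambda>i. cmap D ?w (ord_succ i) y"])
      fix i assume i: "i \<in> elts ?w"
      show "cmap D ?w (ord_succ i) y \<in> elts (cob (map_chain F D) i)"
        using fs_app[OF ordinal_succ[OF om[OF i]] ordinal_omega le[OF succ_in_omega[OF i]] y]
        by (simp add: map_chain_def final_sequence_succ[OF om[OF i]])
    next
      fix i j assume i: "i \<in> elts ?w" and j: "j \<in> elts ?w" and ij: "ord_le i j"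
      show "cmap (map_chain F D) j i (cmap D ?w (ord_succ j) y) = cmap D ?w (ord_succ i) y"
        using fs_comp[OF ordinal_succ[OF om[OF i]] ordinal_succ[OF om[OF j]] ordinal_omega
            ord_succ_mono[OF om[OF i] om[OF j] ij] le[OF succ_in_omega[OF j]] y]
        by (simp add: map_chain_def final_sequence_succ_map[OF om[OF i] om[OF j] ij])
    qed (blast intro: that)
    let ?x = "cmap D ?w' ?w x"
    have x': "?x \<in> elts (cob D ?w)" by (rule fs_app[OF ordinal_omega ow' ord_le_succ x])
    have "?x = y"
    proof (rule limit_cone_inj[OF final_sequence_limit[OF limit_ordinal_omega] x' y])
      fix i assume i: "i \<in> elts ?w"
      \<comment> \<open>The shifted cone gives agreement only at stages i+1; projecting down one
        stage reaches every \<open>i\<close>, including 0.\<close>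
      have "cmap D ?w i z = cmap D (ord_succ i) i (cmap D ?w (ord_succ i) z)"
        if "z \<in> elts (cob D ?w)" for z
        using fs_comp[OF om[OF i] ordinal_succ[OF om[OF i]] ordinal_omega ord_le_succ
            le[OF succ_in_omega[OF i]] that] by simp
      then show "cmap D ?w i ?x = cmap D ?w i y" using x' y factor[OF i x] xy[OF i] by simp
    qed
    then show ?thesis using x by blast
  qed
  ultimately show ?thesis
    using fs_app[OF ordinal_omega ow' ord_le_succ] by (auto simp: bij_betw_def)
qed

text \<open>Transfinite induction from \<omega>. Functors preserve bijections, which settles
  successors. At a limit all earlier stages from \<omega> on are already in bijection with stage
  \<omega>, so a thread is determined by its component there, which can be arbitrary.\<close>

lemma final_sequence_above_omega_bij:
  assumes cont: "omega_continuous F" and "ordinal i" "ord_le ord_omega i"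
  shows "bij_betw (cmap D i ord_omega) (elts (cob D i)) (elts (cob D ord_omega))"
  using assms(2,3)
proof (induction i rule: wf_induct_rule[OF foundation])
  case (1 i)
  let ?w = "ord_omega :: 'v"
  note IH = 1(1) and oi = 1(2) and wi = 1(3)
  from oi wi show ?case
  proof (cases rule: ordinal_above_omega_cases)
    case 1
    have "cmap D ?w ?w = idm (cob D ?w)" by (rule chain_id[OF final_sequence_chain ordinal_omega])
    then show ?thesis unfolding 1 by (simp add: bij_betw_def idm_def inj_on_def)
  next
    case (2 k)
    have "bij_betw (cmap D k ?w) (elts (cob D k)) (elts (cob D ?w))" using IH 2 by simp
    \<comment> \<open>\<open>F\<close> turns the map from \<open>k\<close> to \<omega> into the map
      from k+1 to \<omega>+1; \<open>final_sequence_omega_succ_bij\<close> covers the last step down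
      to \<omega>.\<close>
    from functor_bij[OF F fs_hom[OF ordinal_omega 2(1,2)] this]
    have "bij_betw (cmap D i (ord_succ ?w)) (elts (cob D i)) (elts (cob D (ord_succ ?w)))"
      using 2 by (simp add: final_sequence_succ final_sequence_succ_map ordinal_omega)
    from bij_betw_trans[OF this final_sequence_omega_succ_bij[OF cont]]
    show ?thesis
      by (rule bij_betw_cong[THEN iffD1, rotated])
        (use 2 fs_comp[OF ordinal_omega ordinal_succ[OF ordinal_omega] oi ord_le_succ] in
          \<open>simp add: ord_succ_mono ordinal_omega\<close>)
  next
    case 3
    have om: "ordinal j" if "j \<in> elts i" for j using that by (rule ordinal_elt[OF oi])
    have le: "ord_le j i" if "j \<in> elts i" for j using that by (rule ordinal_elt_le[OF oi])
    have bij: "bij_betw (cmap D j ?w) (elts (cob D j)) (elts (cob D ?w))"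
      if "j \<in> elts i" "ord_le ?w j" for j using IH[of j] om that by simp
    have cases: "ord_le j ?w \<or> ord_le ?w j" if "j \<in> elts i" for j
      using ordinal_cases_le[OF om[OF that] ordinal_omega] ordinal_elt_le[OF ordinal_omega] by blast
    have "inj_on (cmap D i ?w) (elts (cob D i))"
    proof (rule inj_onI)
      fix x y assume x: "x \<in> elts (cob D i)" and y: "y \<in> elts (cob D i)"
        and eq: "cmap D i ?w x = cmap D i ?w y"
      \<comment> \<open>Projections to stages up to \<omega> factor through \<omega>; from \<omega>
        on, equality is tested after the injective map to stage \<omega>.\<close>
      show "x = y"
      proof (rule limit_cone_inj[OF final_sequence_limit[OF 3(1)] x y])
        fix j assume j: "j \<in> elts i"
        from cases[OF j] show "cmap D i j x = cmap D i j y"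
        proof
          assume "ord_le j ?w"
          then show ?thesis
            using fs_comp[OF om[OF j] ordinal_omega oi _ wi] x y eq by metis
        next
          assume wj: "ord_le ?w j"
          have "cmap D j ?w (cmap D i j x) = cmap D j ?w (cmap D i j y)"
            using fs_comp[OF ordinal_omega om[OF j] oi wj le[OF j]] x y eq by metis
          then show ?thesis
            using bij[OF j wj] fs_app[OF om[OF j] oi le[OF j]] x y
            by (metis bij_betw_def inj_onD)
        qed
      qed
    qed
    moreover have "y \<in> cmap D i ?w ` elts (cob D i)" if y: "y \<in> elts (cob D ?w)" for y
    proof -
      \<comment> \<open>The thread with component \<open>y\<close> at \<omega>: project
        \<open>y\<close> to lower stages and invert the bijections at higher ones. Both
        prescriptions agree at \<omega>, so \<open>b_down\<close> includes that stage.\<close>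
      define b where "b j = (if ord_le ?w j then inv_into (elts (cob D j)) (cmap D j ?w) y else cmap D ?w j y)" for j
      have b_up: "b j \<in> elts (cob D j)" "cmap D j ?w (b j) = y" if "j \<in> elts i" "ord_le ?w j" for j
        using bij[OF that] y that(2) unfolding b_def
        by (simp_all add: bij_betw_def inv_into_into f_inv_into_f)
      have b_down: "b j = cmap D ?w j y" if "j \<in> elts i" "ord_le j ?w" for j
      proof (cases "ord_le ?w j")
        case True
        then have "j = ?w" using that ord_le_antisym by blast
        then show ?thesis using b_up[OF that(1) True] fs_id[OF ordinal_omega] y by metis
      qed (simp add: b_def)
      obtain x where x: "x \<in> elts (cob D i)" "\<And>j. j \<in> elts i \<Longrightarrow> cmap D i j x = b j"
      proof (rule limit_cone_surj[OF final_sequence_limit[OF 3(1)], where b = b])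
        fix j assume j: "j \<in> elts i"
        then show "b j \<in> elts (cob D j)"
          using cases[OF j] b_up b_down fs_app[OF om[OF j] ordinal_omega _ y] by metis
      next
        fix j k assume j: "j \<in> elts i" and k: "k \<in> elts i" and jk: "ord_le j k"
        \<comment> \<open>The cases locate \<omega> relative to \<open>j\<close> and
          \<open>k\<close>; in the last one equality is tested in stage \<omega>.\<close>
        consider "ord_le k ?w" | "ord_le ?w k" "ord_le j ?w" | "ord_le ?w k" "ord_le ?w j"
          using cases j k by blast
        then show "cmap D k j (b k) = b j"
        proof cases
          case 1
          then show ?thesis
            using fs_comp[OF om[OF j] om[OF k] ordinal_omega jk 1 y] b_down[OF k 1]
              b_down[OF j ord_le_trans[OF jk 1]] by simp
        next
          case 2
          have "cmap D k j (b k) = cmap D ?w j (cmap D k ?w (b k))"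
            using fs_comp[OF om[OF j] ordinal_omega om[OF k] 2(2,1) b_up(1)[OF k 2(1)]] by simp
          then show ?thesis by (simp add: b_up(2)[OF k 2(1)] b_down[OF j 2(2)])
        next
          case 3
          have "cmap D j ?w (cmap D k j (b k)) = cmap D j ?w (b j)"
            using fs_comp[OF ordinal_omega om[OF j] om[OF k] 3(2) jk b_up(1)[OF k 3(1)]]
              b_up(2)[OF k 3(1)] b_up(2)[OF j 3(2)] by simp
          then show ?thesis
            using bij[OF j 3(2)] fs_app[OF om[OF j] om[OF k] jk b_up(1)[OF k 3(1)]] b_up(1)[OF j 3(2)]
            by (metis bij_betw_def inj_onD)
        qed
      qed (blast intro: that)
      have "cmap D i ?w x = y"
        using x(2)[OF 3(2)] b_down[OF 3(2) ord_le_refl] fs_id[OF ordinal_omega y] by simp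
      then show ?thesis using x(1) by blast
    qed
    ultimately show ?thesis using fs_app[OF ordinal_omega oi wi] by (auto simp: bij_betw_def)
  qed
qed

end

section \<open>The functor of causal functions\<close>

lemma causal_app:
  "causal D E X \<alpha> \<Longrightarrow> f \<in> hom X (cob D ord_omega) \<Longrightarrow> vapp \<alpha> (vlambda X f) \<in> elts (cob E ord_omega)"
  by (rule vexp_app[OF _ vlambda_in_vexp]) (simp_all add: causal_def)

text \<open>\<open>causal\<close> speaks of graphs in \<open>vexp\<close>; this lemma and the next
  pass to morphisms, so that later arguments can work with composites.\<close>

lemma causalD:
  assumes "causal D E X \<alpha>" "f \<in> hom X (cob D ord_omega)" "g \<in> hom X (cob D ord_omega)"
    and "i \<in> elts ord_omega"
    and "compose (elts X) (cmap D ord_omega i) f = compose (elts X) (cmap D ord_omega i) g"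
  shows "cmap E ord_omega i (vapp \<alpha> (vlambda X f)) = cmap E ord_omega i (vapp \<alpha> (vlambda X g))"
  using assms vlambda_in_vexp[OF assms(2)] vlambda_in_vexp[OF assms(3)]
  unfolding causal_def by (metis vfun_vlambda)

lemma causal_vlambdaI:
  assumes mem: "\<And>f. f \<in> hom X (cob D ord_omega) \<Longrightarrow> \<phi> (vlambda X f) \<in> elts (cob E ord_omega)"
    and caus: "\<And>f g i. f \<in> hom X (cob D ord_omega) \<Longrightarrow> g \<in> hom X (cob D ord_omega) \<Longrightarrow> i \<in> elts ord_omega \<Longrightarrow>
      compose (elts X) (cmap D ord_omega i) f = compose (elts X) (cmap D ord_omega i) g \<Longrightarrow>
      cmap E ord_omega i (\<phi> (vlambda X f)) = cmap E ord_omega i (\<phi> (vlambda X g))"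
  shows "causal D E X (vlambda (vexp (cob D ord_omega) X) \<phi>)"
  unfolding causal_def
proof (intro conjI ballI impI)
  show "vlambda (vexp (cob D ord_omega) X) \<phi> \<in> elts (vexp (cob E ord_omega) (vexp (cob D ord_omega) X))"
    by (rule vlambda_in_vexp') (auto simp: elts_vexp mem)
next
  fix h k i
  assume h: "h \<in> elts (vexp (cob D ord_omega) X)" and k: "k \<in> elts (vexp (cob D ord_omega) X)"
    and i: "i \<in> elts ord_omega"
    and eq: "compose (elts X) (cmap D ord_omega i) (vfun X h) = compose (elts X) (cmap D ord_omega i) (vfun X k)"
  obtain f where f: "f \<in> hom X (cob D ord_omega)" "h = vlambda X f" using h by (rule vexpE)
  obtain g where g: "g \<in> hom X (cob D ord_omega)" "k = vlambda X g" using k by (rule vexpE)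
  show "cmap E ord_omega i (vapp (vlambda (vexp (cob D ord_omega) X) \<phi>) h) =
      cmap E ord_omega i (vapp (vlambda (vexp (cob D ord_omega) X) \<phi>) k)"
    using caus[OF f(1) g(1) i] eq h k f g by (simp add: vapp_vlambda vfun_vlambda)
qed

lemma causal_ext:
  assumes "causal D E X \<alpha>" "causal D E X \<beta>"
    and "\<And>f. f \<in> hom X (cob D ord_omega) \<Longrightarrow> vapp \<alpha> (vlambda X f) = vapp \<beta> (vlambda X f)"
  shows "\<alpha> = \<beta>"
proof (rule vexp_ext)
  show "\<alpha> \<in> elts (vexp (cob E ord_omega) (vexp (cob D ord_omega) X))"
    and "\<beta> \<in> elts (vexp (cob E ord_omega) (vexp (cob D ord_omega) X))"
    using assms(1,2) by (simp_all add: causal_def)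
  show "vapp \<alpha> x = vapp \<beta> x" if "x \<in> elts (vexp (cob D ord_omega) X)" for x
    using that assms(3) by (auto elim: vexpE)
qed

section \<open>Action on morphisms and functoriality\<close>

lemma Ob_causal_functor: "elts (Ob (causal_functor D E) X) = {\<alpha>. causal D E X \<alpha>}"
  by (simp add: causal_functor_def elts_causal_obj)

lemma Ar_causal_functor_app:
  "causal D E X \<alpha> \<Longrightarrow> h \<in> hom X Y \<Longrightarrow> f \<in> hom Y (cob D ord_omega) \<Longrightarrow>
    vapp (Ar (causal_functor D E) X Y h \<alpha>) (vlambda Y f) = vapp \<alpha> (vlambda X (compose (elts X) f h))"
  by (simp add: causal_functor_def elts_causal_obj vapp_vlambda vlambda_in_vexp vfun_vlambda)

text \<open>If two morphisms out of \<open>Y\<close> agree at stage \<open>i\<close>, so do their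
  composites with \<open>h\<close>, to which causality of \<alpha> applies.\<close>

lemma causal_Ar:
  assumes \<alpha>: "causal D E X \<alpha>" and h: "h \<in> hom X Y"
  shows "causal D E Y (Ar (causal_functor D E) X Y h \<alpha>)"
proof -
  have "causal D E Y (vlambda (vexp (cob D ord_omega) Y)
      (\<lambda>f. vapp \<alpha> (vlambda X (compose (elts X) (vfun Y f) h))))"
  proof (rule causal_vlambdaI)
    fix f assume f: "f \<in> hom Y (cob D ord_omega)"
    then show "vapp \<alpha> (vlambda X (compose (elts X) (vfun Y (vlambda Y f)) h)) \<in> elts (cob E ord_omega)"
      using causal_app[OF \<alpha> compose_hom[OF h f]] by (simp add: vfun_vlambda)
  next
    fix f g i
    assume f: "f \<in> hom Y (cob D ord_omega)" and g: "g \<in> hom Y (cob D ord_omega)"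
      and i: "i \<in> elts ord_omega"
      and "compose (elts Y) (cmap D ord_omega i) f = compose (elts Y) (cmap D ord_omega i) g"
    then have "compose (elts X) (cmap D ord_omega i) (compose (elts X) f h) =
        compose (elts X) (cmap D ord_omega i) (compose (elts X) g h)"
      by (simp add: compose_assoc_hom[OF h])
    from causalD[OF \<alpha> compose_hom[OF h f] compose_hom[OF h g] i this]
    show "cmap E ord_omega i (vapp \<alpha> (vlambda X (compose (elts X) (vfun Y (vlambda Y f)) h))) =
        cmap E ord_omega i (vapp \<alpha> (vlambda X (compose (elts X) (vfun Y (vlambda Y g)) h)))"
      using f g by (simp add: vfun_vlambda)
  qed
  then show ?thesis using \<alpha> by (simp add: causal_functor_def elts_causal_obj)
qed

lemma Ar_causal_functor_hom:
  "h \<in> hom X Y \<Longrightarrow>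
    Ar (causal_functor D E) X Y h \<in> hom (Ob (causal_functor D E) X) (Ob (causal_functor D E) Y)"
  using causal_Ar[of D E X _ h Y]
  by (auto simp: hom_def PiE_def extensional_def Ob_causal_functor)
    (simp add: causal_functor_def elts_causal_obj)

lemma is_functor_causal_functor: "is_functor (causal_functor D E)"
  unfolding is_functor_def
proof (intro conjI allI ballI)
  let ?R = "causal_functor D E"
  fix X Y Z f g
  show "Ar ?R X Y f \<in> hom (Ob ?R X) (Ob ?R Y)" if "f \<in> hom X Y"
    using that by (rule Ar_causal_functor_hom)
  show "Ar ?R X X (idm X) = idm (Ob ?R X)"
  proof (rule hom_ext[OF Ar_causal_functor_hom[OF idm_hom] idm_hom])
    fix \<alpha> assume "\<alpha> \<in> elts (Ob ?R X)"
    then have \<alpha>: "causal D E X \<alpha>" by (simp add: Ob_causal_functor)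
    have "Ar ?R X X (idm X) \<alpha> = \<alpha>"
      by (rule causal_ext[OF causal_Ar[OF \<alpha> idm_hom] \<alpha>])
        (simp add: Ar_causal_functor_app[OF \<alpha> idm_hom] compose_idm_right)
    then show "Ar ?R X X (idm X) \<alpha> = idm (Ob ?R X) \<alpha>"
      using \<alpha> by (simp add: idm_def Ob_causal_functor)
  qed
  assume f: "f \<in> hom X Y" and g: "g \<in> hom Y Z"
  show "Ar ?R X Z (compose (elts X) g f) = compose (elts (Ob ?R X)) (Ar ?R Y Z g) (Ar ?R X Y f)"
  proof (rule hom_ext[OF Ar_causal_functor_hom[OF compose_hom[OF f g]]
        compose_hom[OF Ar_causal_functor_hom[OF f] Ar_causal_functor_hom[OF g]]])
    fix \<alpha> assume "\<alpha> \<in> elts (Ob ?R X)"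
    then have \<alpha>: "causal D E X \<alpha>" by (simp add: Ob_causal_functor)
    have "Ar ?R X Z (compose (elts X) g f) \<alpha> = Ar ?R Y Z g (Ar ?R X Y f \<alpha>)"
      by (rule causal_ext[OF causal_Ar[OF \<alpha> compose_hom[OF f g]] causal_Ar[OF causal_Ar[OF \<alpha> f] g]])
        (simp add: Ar_causal_functor_app[OF \<alpha> compose_hom[OF f g]]
          Ar_causal_functor_app[OF causal_Ar[OF \<alpha> f] g] Ar_causal_functor_app[OF \<alpha> f]
          compose_hom[OF g] compose_assoc_hom[OF f])
    then show "Ar ?R X Z (compose (elts X) g f) \<alpha> = compose (elts (Ob ?R X)) (Ar ?R Y Z g) (Ar ?R X Y f) \<alpha>"
      using \<alpha> by (simp add: compose_def Ob_causal_functor)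
  qed
qed

section \<open>The counit and the transpose\<close>

text \<open>All lifts \<open>s\<close> are quantified instead of one being chosen for each kind of
  \<open>i\<close>, so that restriction along the chain needs no case split. Where no lift exists,
  only membership in \<open>cob E i\<close> is asked; this happens at stage 0 when stage \<omega> of
  \<open>D\<close> is empty.\<close>

definition counit_value :: "'v::zfc_universe chain \<Rightarrow> 'v chain \<Rightarrow> 'v \<Rightarrow> 'v \<Rightarrow> 'v \<Rightarrow> bool" where
  "counit_value D E i \<alpha> b \<longleftrightarrow> b \<in> elts (cob E i) \<and>
     (\<forall>j s. ordinal j \<longrightarrow> ord_le j i \<longrightarrow> ord_le j ord_omega \<longrightarrow> s \<in> hom (cob D i) (cob D ord_omega) \<longrightarrow>
        compose (elts (cob D i)) (cmap D ord_omega j) s = cmap D i j \<longrightarrow>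
        cmap E i j b = cmap E ord_omega j (vapp \<alpha> (vlambda (cob D i) s)))"

definition causal_counit :: "'v::zfc_universe chain \<Rightarrow> 'v chain \<Rightarrow> 'v \<Rightarrow> 'v \<Rightarrow> 'v" where
  "causal_counit D E i = (\<lambda>\<alpha>\<in>elts (causal_obj D E (cob D i)). THE b. counit_value D E i \<alpha> b)"

context
  fixes A B :: "'v::zfc_universe set_functor" and D E :: "'v chain"
  assumes A: "is_functor A" and B: "is_functor B" and B_cont: "omega_continuous B"
    and D: "is_final_sequence A D" and E: "is_final_sequence B E"
begin

lemmas D_chain = final_sequence_chain[OF A D]
  and E_chain = final_sequence_chain[OF B E]

text \<open>A lift \<open>t\<close> of the connecting map to the largest available stage \<open>m\<close> decides the value.\<close>

lemma counit_value_ex1: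
  assumes i: "ordinal i" and \<alpha>: "causal D E (cob D i) \<alpha>"
    and m: "ordinal m" "ord_le m i" "ord_le m ord_omega"
    and m_max: "\<And>j. ordinal j \<Longrightarrow> ord_le j i \<Longrightarrow> ord_le j ord_omega \<Longrightarrow> ord_le j m"
    and t: "t \<in> hom (cob D i) (cob D ord_omega)" "compose (elts (cob D i)) (cmap D ord_omega m) t = cmap D i m"
    and bij: "bij_betw (cmap E i m) (elts (cob E i)) (elts (cob E m))"
  shows "\<exists>!b. counit_value D E i \<alpha> b"
proof -
  let ?w = "ord_omega :: 'v" and ?X = "cob D i"
  have \<alpha>t: "vapp \<alpha> (vlambda ?X t) \<in> elts (cob E ?w)" by (rule causal_app[OF \<alpha> t(1)])
  then have "cmap E ?w m (vapp \<alpha> (vlambda ?X t)) \<in> elts (cob E m)"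
    by (rule chain_app[OF E_chain m(1) ordinal_omega m(3)])
  then obtain b where b: "b \<in> elts (cob E i)" "cmap E i m b = cmap E ?w m (vapp \<alpha> (vlambda ?X t))"
    using bij by (metis bij_betw_imp_surj_on imageE)
  have "counit_value D E i \<alpha> b"
    unfolding counit_value_def
  proof (intro conjI allI impI)
    fix j s
    assume j: "ordinal j" "ord_le j i" "ord_le j ?w" and s: "s \<in> hom ?X (cob D ?w)"
      and sj: "compose (elts ?X) (cmap D ?w j) s = cmap D i j"
    have jm: "ord_le j m" by (rule m_max[OF j])
    \<comment> \<open>A lift of the map to stage \<open>m\<close> also lifts the map to every lower
      stage \<open>j\<close>.\<close>
    have tj: "compose (elts ?X) (cmap D ?w j) t = cmap D i j"
    proof -
      have "compose (elts ?X) (cmap D ?w j) t =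
          compose (elts ?X) (compose (elts (cob D ?w)) (cmap D m j) (cmap D ?w m)) t"
        by (simp add: chain_comp[OF D_chain j(1) m(1) ordinal_omega jm m(3)])
      also have "\<dots> = compose (elts ?X) (cmap D m j) (cmap D i m)"
        by (simp add: compose_assoc_hom[OF t(1), symmetric] t(2))
      also have "\<dots> = cmap D i j" by (rule chain_comp[OF D_chain j(1) m(1) i jm m(2)])
      finally show ?thesis .
    qed
    \<comment> \<open>Below \<omega> causality equates the two values; at \<omega> the lifting
      condition itself forces \<open>s = t\<close>.\<close>
    have "cmap E ?w j (vapp \<alpha> (vlambda ?X s)) = cmap E ?w j (vapp \<alpha> (vlambda ?X t))"
    proof (cases "j \<in> elts ?w")
      case True
      then show ?thesis using causalD[OF \<alpha> s t(1) True] sj tj by simp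
    next
      case False
      then have "j = ?w" using ordinal_cases_le[OF j(1) ordinal_omega] j(3) ord_le_antisym by blast
      then have "s = t"
        using sj tj compose_idm_left[OF s] compose_idm_left[OF t(1)] chain_id[OF D_chain ordinal_omega]
        by metis
      then show ?thesis by simp
    qed
    also have "\<dots> = cmap E m j (cmap E i m b)"
      by (simp add: b(2) chain_comp_app[OF E_chain j(1) m(1) ordinal_omega jm m(3) \<alpha>t])
    also have "\<dots> = cmap E i j b"
      by (rule chain_comp_app[OF E_chain j(1) m(1) i jm m(2) b(1)])
    finally show "cmap E i j b = cmap E ?w j (vapp \<alpha> (vlambda ?X s))" by simp
  qed (rule b(1))
  \<comment> \<open>Testing \<open>c\<close> with the lift \<open>t\<close> at stage
    \<open>m\<close> fixes its image under the injective map \<open>cmap E i m\<close>.\<close>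
  moreover have "c = b" if "counit_value D E i \<alpha> c" for c
  proof -
    have "c \<in> elts (cob E i)" "cmap E i m c = cmap E i m b"
      using that m t b(2) by (auto simp: counit_value_def)
    then show ?thesis using bij b(1) by (metis bij_betw_def inj_onD)
  qed
  ultimately show ?thesis by blast
qed

text \<open>Where \<open>counit_value_ex1\<close> applies, the deciding stage \<open>m\<close> is
  the smaller of \<open>i\<close> and \<omega>. Up to \<omega> the map \<open>cmap E i m\<close> is
  an identity; above \<omega> it is bijective by continuity of \<open>B\<close>.\<close>

lemma counit_value_unique:
  assumes i: "ordinal i" and \<alpha>: "causal D E (cob D i) \<alpha>"
  shows "\<exists>!b. counit_value D E i \<alpha> b"
proof -
  let ?w = "ord_omega :: 'v"
  have below: "\<exists>!b. counit_value D E i \<alpha> b"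
    if iw: "ord_le i ?w" and surj: "elts (cob D i) \<subseteq> cmap D ?w i ` elts (cob D ?w)"
  proof -
    obtain t where t: "t \<in> hom (cob D i) (cob D ?w)"
      "compose (elts (cob D i)) (cmap D ?w i) t = idm (cob D i)"
      using hom_section[OF chain_hom[OF D_chain i ordinal_omega iw] surj] .
    have "bij_betw (cmap E i i) (elts (cob E i)) (elts (cob E i))"
      by (simp add: chain_id[OF E_chain i] idm_def bij_betw_def inj_on_def)
    then show ?thesis
      using counit_value_ex1[OF i \<alpha> i ord_le_refl iw _ t(1)] t(2) chain_id[OF D_chain i] by simp
  qed
  consider "ord_le ?w i" | "i = ord_zero" | n where "i = ord_of_nat n" "0 < n"
    using ordinal_cases_le[OF i ordinal_omega] by (auto simp: elts_ord_omega) (metis ord_of_nat.simps(1) gr0I)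
  then show ?thesis
  proof cases
    case 1
    have hom: "cmap D i ?w \<in> hom (cob D i) (cob D ?w)" by (rule chain_hom[OF D_chain ordinal_omega i 1])
    show ?thesis
      by (rule counit_value_ex1[OF i \<alpha> ordinal_omega 1 ord_le_refl _ hom])
        (use hom in \<open>simp_all add: chain_id[OF D_chain ordinal_omega] compose_idm_left
          final_sequence_above_omega_bij[OF B E B_cont i 1]\<close>)
  next
    case 2
    have iw: "ord_le i ?w" by (simp add: 2 ord_zero_le)
    obtain d where d: "elts (cob D i) = {d}" using final_sequence_zero[OF A D] 2 by (auto simp: is_singleton_def)
    obtain e where e: "elts (cob E i) = {e}" using final_sequence_zero[OF B E] 2 by (auto simp: is_singleton_def)
    \<comment> \<open>If stage \<omega> is empty, the singleton stage 0 has no map into it and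
      \<open>e\<close> is the only candidate. Otherwise any point of stage \<omega> makes the
      projection surjective.\<close>
    show ?thesis
    proof (cases "elts (cob D ?w) = {}")
      case True
      then have "hom (cob D i) (cob D ?w) = {}" using d by (auto simp: hom_def)
      then show ?thesis using e by (auto simp: counit_value_def)
    next
      case False
      then show ?thesis
        using below[OF iw] d chain_app[OF D_chain i ordinal_omega iw] by fastforce
    qed
  next
    case 3
    then show ?thesis using below ord_of_nat_le_omega final_sequence_omega_surj[OF A D] by blast
  qed
qed

section \<open>Values and naturality of the counit\<close>

lemma causal_counit_eq:
  "ordinal i \<Longrightarrow> causal D E (cob D i) \<alpha> \<Longrightarrow> counit_value D E i \<alpha> b \<Longrightarrow> causal_counit D E i \<alpha> = b"
  using the1_equality[OF counit_value_unique] by (simp add: causal_counit_def elts_causal_obj)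

lemma counit_value_causal_counit:
  "ordinal i \<Longrightarrow> causal D E (cob D i) \<alpha> \<Longrightarrow> counit_value D E i \<alpha> (causal_counit D E i \<alpha>)"
  using theI'[OF counit_value_unique] by (simp add: causal_counit_def elts_causal_obj)

lemma causal_counit_hom:
  "ordinal i \<Longrightarrow> causal_counit D E i \<in> hom (Ob (causal_functor D E) (cob D i)) (cob E i)"
  using counit_value_causal_counit[of i]
  by (auto simp: hom_def PiE_def extensional_def counit_value_def Ob_causal_functor)
    (simp add: causal_counit_def elts_causal_obj)

text \<open>With both \<open>i\<close> and \<open>j\<close> equal to \<omega>, the identity is an
  admissible lift, and \<open>cmap E ord_omega ord_omega\<close> is the identity.\<close>

lemma causal_counit_omega:
  assumes "causal D E (cob D ord_omega) \<alpha>"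
  shows "causal_counit D E ord_omega \<alpha> = vapp \<alpha> (vlambda (cob D ord_omega) (idm (cob D ord_omega)))"
proof -
  let ?w = "ord_omega :: 'v"
  let ?b = "causal_counit D E ?w \<alpha>" and ?c = "vapp \<alpha> (vlambda (cob D ?w) (idm (cob D ?w)))"
  have v: "counit_value D E ?w \<alpha> ?b" by (rule counit_value_causal_counit[OF ordinal_omega assms])
  then have "cmap E ?w ?w ?b = cmap E ?w ?w ?c"
    unfolding counit_value_def
    using ordinal_omega ord_le_refl idm_hom[of "cob D ?w"] compose_idm_left[OF idm_hom[of "cob D ?w"]]
      chain_id[OF D_chain ordinal_omega] by metis
  then show ?thesis
    using v causal_app[OF assms idm_hom] chain_id_app[OF E_chain ordinal_omega]
    by (simp add: counit_value_def)
qed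

text \<open>Naturality of the counit in relational form: precomposing a lift at \<open>i\<close>
  with the connecting map from \<open>k\<close> gives a lift at \<open>k\<close>.\<close>

lemma counit_value_restrict:
  assumes i: "ordinal i" and k: "ordinal k" and ik: "ord_le i k"
    and \<alpha>: "causal D E (cob D k) \<alpha>" and b: "counit_value D E k \<alpha> b"
  shows "counit_value D E i (Ar (causal_functor D E) (cob D k) (cob D i) (cmap D k i) \<alpha>) (cmap E k i b)"
  unfolding counit_value_def
proof (intro conjI allI impI)
  let ?w = "ord_omega :: 'v"
  have bE: "b \<in> elts (cob E k)" using b by (simp add: counit_value_def)
  then show "cmap E k i b \<in> elts (cob E i)" by (rule chain_app[OF E_chain i k ik])
  have ki: "cmap D k i \<in> hom (cob D k) (cob D i)" by (rule chain_hom[OF D_chain i k ik])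
  fix j s
  assume j: "ordinal j" "ord_le j i" "ord_le j ?w" and s: "s \<in> hom (cob D i) (cob D ?w)"
    and sj: "compose (elts (cob D i)) (cmap D ?w j) s = cmap D i j"
  let ?s = "compose (elts (cob D k)) s (cmap D k i)"
  have "compose (elts (cob D k)) (cmap D ?w j) ?s = cmap D k j"
    by (simp add: compose_assoc_hom[OF ki] sj chain_comp[OF D_chain j(1) i k j(2) ik])
  then have "cmap E k j b = cmap E ?w j (vapp \<alpha> (vlambda (cob D k) ?s))"
    using b j ord_le_trans[OF j(2) ik] compose_hom[OF ki s] unfolding counit_value_def by blast
  then show "cmap E i j (cmap E k i b) =
      cmap E ?w j (vapp (Ar (causal_functor D E) (cob D k) (cob D i) (cmap D k i) \<alpha>) (vlambda (cob D i) s))"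
    by (simp add: chain_comp_app[OF E_chain j(1) i k j(2) ik bE] Ar_causal_functor_app[OF \<alpha> ki s])
qed

lemma causal_counit_chain_trans:
  "is_chain_trans ordinals (map_chain (causal_functor D E) D) E (causal_counit D E)"
  unfolding is_chain_trans_def map_chain_def
proof (intro conjI ballI impI, simp_all only: chain.simps ordinals_def mem_Collect_eq)
  let ?R = "causal_functor D E"
  fix i k :: 'v
  assume i: "ordinal i" and k: "ordinal k" and ik: "ord_le i k"
  have ki: "cmap D k i \<in> hom (cob D k) (cob D i)" by (rule chain_hom[OF D_chain i k ik])
  have "causal_counit D E i (Ar ?R (cob D k) (cob D i) (cmap D k i) \<alpha>) = cmap E k i (causal_counit D E k \<alpha>)"
    if \<alpha>: "causal D E (cob D k) \<alpha>" for \<alpha>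
    by (rule causal_counit_eq[OF i causal_Ar[OF \<alpha> ki]
          counit_value_restrict[OF i k ik \<alpha> counit_value_causal_counit[OF k \<alpha>]]])
  then show "compose (elts (Ob ?R (cob D k))) (causal_counit D E i) (Ar ?R (cob D k) (cob D i) (cmap D k i)) =
      compose (elts (Ob ?R (cob D k))) (cmap E k i) (causal_counit D E k)"
    by (auto simp: compose_def Ob_causal_functor intro!: restrict_ext)
qed (rule causal_counit_hom)

section \<open>The transpose of a transformation and its uniqueness\<close>

context
  fixes F :: "'v set_functor" and \<alpha>
  assumes F: "is_functor F" and \<alpha>: "is_chain_trans ordinals (map_chain F D) E \<alpha>"
begin

lemma chain_trans_hom: "ordinal i \<Longrightarrow> \<alpha> i \<in> hom (Ob F (cob D i)) (cob E i)"
  using \<alpha> by (simp add: is_chain_trans_def map_chain_def ordinals_def)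

lemma chain_trans_natural:
  assumes "ordinal i" "ordinal j" "ord_le i j" "S \<in> elts (Ob F (cob D j))"
  shows "cmap E j i (\<alpha> j S) = \<alpha> i (Ar F (cob D j) (cob D i) (cmap D j i) S)"
proof -
  have "compose (elts (Ob F (cob D j))) (\<alpha> i) (Ar F (cob D j) (cob D i) (cmap D j i)) =
      compose (elts (Ob F (cob D j))) (cmap E j i) (\<alpha> j)"
    using \<alpha> assms(1-3) by (simp add: is_chain_trans_def map_chain_def ordinals_def)
  then show ?thesis using assms(4) by (metis compose_eq)
qed

text \<open>The right side sees \<open>f\<close> only through its composite with the projection to
  stage \<open>i\<close>; for finite \<open>i\<close> this is the causality of the
  transpose.\<close>

lemma chain_trans_omega:
  assumes i: "ordinal i" "ord_le i ord_omega" and f: "f \<in> hom X (cob D ord_omega)" and S: "S \<in> elts (Ob F X)"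
  shows "cmap E ord_omega i (\<alpha> ord_omega (Ar F X (cob D ord_omega) f S)) =
    \<alpha> i (Ar F X (cob D i) (compose (elts X) (cmap D ord_omega i) f) S)"
  using chain_trans_natural[OF i(1) ordinal_omega i(2) functor_app[OF F f S]]
    functor_comp[OF F f chain_hom[OF D_chain i(1) ordinal_omega i(2)] S] by simp

lemma causal_causal_transpose:
  assumes S: "S \<in> elts (Ob F X)"
  shows "causal D E X (causal_transpose D F \<alpha> X S)"
proof -
  have "causal D E X (vlambda (vexp (cob D ord_omega) X)
      (\<lambda>f. \<alpha> ord_omega (Ar F X (cob D ord_omega) (vfun X f) S)))"
    by (rule causal_vlambdaI)
      (auto simp: vfun_vlambda chain_trans_omega[OF _ _ _ S] ordinal_elt[OF ordinal_omega]
        ordinal_elt_le[OF ordinal_omega] intro!: hom_app[OF chain_trans_hom] functor_app[OF F _ S] ordinal_omega)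
  then show ?thesis using S by (simp add: causal_transpose_def)
qed

lemma causal_transpose_app:
  "S \<in> elts (Ob F X) \<Longrightarrow> f \<in> hom X (cob D ord_omega) \<Longrightarrow>
    vapp (causal_transpose D F \<alpha> X S) (vlambda X f) = \<alpha> ord_omega (Ar F X (cob D ord_omega) f S)"
  by (simp add: causal_transpose_def vapp_vlambda vlambda_in_vexp vfun_vlambda)

lemma causal_transpose_hom: "causal_transpose D F \<alpha> X \<in> hom (Ob F X) (Ob (causal_functor D E) X)"
  using causal_causal_transpose[of _ X]
  by (auto simp: hom_def PiE_def extensional_def Ob_causal_functor) (simp add: causal_transpose_def)

lemma causal_transpose_nat_trans: "is_nat_trans F (causal_functor D E) (causal_transpose D F \<alpha>)"
  unfolding is_nat_trans_def
proof (intro conjI allI ballI causal_transpose_hom)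
  let ?R = "causal_functor D E" and ?T = "causal_transpose D F \<alpha>"
  fix X Y :: 'v and h assume h: "h \<in> hom X Y"
  have "?T Y (Ar F X Y h S) = Ar ?R X Y h (?T X S)" if S: "S \<in> elts (Ob F X)" for S
    by (rule causal_ext[OF causal_causal_transpose[OF functor_app[OF F h S]]
          causal_Ar[OF causal_causal_transpose[OF S] h]])
      (simp add: causal_transpose_app functor_app[OF F h S] S
        Ar_causal_functor_app[OF causal_causal_transpose[OF S] h] compose_hom[OF h] functor_comp[OF F h _ S])
  then show "compose (elts (Ob F X)) (?T Y) (Ar F X Y h) = compose (elts (Ob F X)) (Ar ?R X Y h) (?T X)"
    by (auto simp: compose_def intro!: restrict_ext)
qed

text \<open>For a lift \<open>s\<close> of the map from \<open>i\<close> to \<open>j\<close>,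
  \<open>chain_trans_omega\<close> turns the transpose at \<open>s\<close> into
  \<open>\<alpha> j\<close> applied after that map, and naturality of \<alpha> gives
  \<open>cmap E i j (\<alpha> i S)\<close>. By uniqueness of counit values this yields the
  factorisation at \<open>i\<close>.\<close>

lemma counit_value_causal_transpose:
  assumes i: "ordinal i" and S: "S \<in> elts (Ob F (cob D i))"
  shows "counit_value D E i (causal_transpose D F \<alpha> (cob D i) S) (\<alpha> i S)"
  unfolding counit_value_def
  by (auto simp: causal_transpose_app[OF S] chain_trans_omega[OF _ _ _ S] chain_trans_natural[OF _ i _ S]
      intro: hom_app[OF chain_trans_hom[OF i] S])

lemma causal_transpose_factors: "factors_as D F \<alpha> (causal_counit D E) (causal_transpose D F \<alpha>)"
  unfolding factors_as_def
proof
  fix i :: 'v assume "i \<in> ordinals"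
  then have i: "ordinal i" by (simp add: ordinals_def)
  show "compose (elts (Ob F (cob D i))) (causal_counit D E i) (causal_transpose D F \<alpha> (cob D i)) = \<alpha> i"
    by (rule hom_ext[OF compose_hom[OF causal_transpose_hom causal_counit_hom[OF i]] chain_trans_hom[OF i]])
      (simp add: compose_def causal_counit_eq[OF i causal_causal_transpose counit_value_causal_transpose[OF i]])
qed

text \<open>Yoneda: naturality along \<open>f\<close> moves evaluation at \<open>f\<close> to
  evaluation at the identity, which is the counit at \<omega>. The assumed equation concerns
  \<omega> alone, so both characterisations of the transpose follow.\<close>

lemma causal_transpose_unique:
  assumes \<gamma>: "is_nat_trans F (causal_functor D E) \<gamma>"
    and eq: "compose (elts (Ob F (cob D ord_omega))) (causal_counit D E ord_omega) (\<gamma> (cob D ord_omega)) = \<alpha> ord_omega"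
  shows "\<gamma> = causal_transpose D F \<alpha>"
proof
  let ?w = "ord_omega :: 'v" and ?R = "causal_functor D E"
  have hom: "\<gamma> X \<in> hom (Ob F X) (Ob ?R X)" for X using \<gamma> by (simp add: is_nat_trans_def)
  have caus: "causal D E X (\<gamma> X S)" if "S \<in> elts (Ob F X)" for X S
    using hom_app[OF hom that] by (simp add: Ob_causal_functor)
  fix X
  show "\<gamma> X = causal_transpose D F \<alpha> X"
  proof (rule hom_ext[OF hom causal_transpose_hom])
    fix S assume S: "S \<in> elts (Ob F X)"
    show "\<gamma> X S = causal_transpose D F \<alpha> X S"
    proof (rule causal_ext[OF caus[OF S] causal_causal_transpose[OF S]])
      fix f assume f: "f \<in> hom X (cob D ?w)"
      let ?S = "Ar F X (cob D ?w) f S"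
      have S': "?S \<in> elts (Ob F (cob D ?w))" by (rule functor_app[OF F f S])
      have "compose (elts (Ob F X)) (\<gamma> (cob D ?w)) (Ar F X (cob D ?w) f) =
          compose (elts (Ob F X)) (Ar ?R X (cob D ?w) f) (\<gamma> X)"
        using \<gamma> f by (simp add: is_nat_trans_def)
      then have nat: "\<gamma> (cob D ?w) ?S = Ar ?R X (cob D ?w) f (\<gamma> X S)" using S by (metis compose_eq)
      have "vapp (\<gamma> X S) (vlambda X f) =
          vapp (Ar ?R X (cob D ?w) f (\<gamma> X S)) (vlambda (cob D ?w) (idm (cob D ?w)))"
        by (simp add: Ar_causal_functor_app[OF caus[OF S] f idm_hom] compose_idm_left[OF f])
      also have "\<dots> = causal_counit D E ?w (\<gamma> (cob D ?w) ?S)"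
        by (simp add: nat[symmetric] causal_counit_omega[OF caus[OF S']])
      also have "\<dots> = \<alpha> ?w ?S" using fun_cong[OF eq, of ?S] S' by (simp add: compose_def)
      finally show "vapp (\<gamma> X S) (vlambda X f) = vapp (causal_transpose D F \<alpha> X S) (vlambda X f)"
        by (simp add: causal_transpose_app[OF S f])
    qed
  qed
qed

text \<open>A cycle: factorisation at all ordinals contains the equation at \<omega>, which forces
  \<gamma> to be the transpose, which in turn factors at all ordinals.\<close>

lemma factors_as_iff:
  assumes \<gamma>: "is_nat_trans F (causal_functor D E) \<gamma>"
  shows "factors_as D F \<alpha> (causal_counit D E) \<gamma> \<longleftrightarrow> \<gamma> = causal_transpose D F \<alpha>"
    and "compose (elts (Ob F (cob D ord_omega))) (causal_counit D E ord_omega) (\<gamma> (cob D ord_omega)) = \<alpha> ord_omega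
      \<longleftrightarrow> \<gamma> = causal_transpose D F \<alpha>"
proof -
  let ?eq = "\<lambda>\<gamma>. compose (elts (Ob F (cob D ord_omega))) (causal_counit D E ord_omega) (\<gamma> (cob D ord_omega)) = \<alpha> ord_omega"
  have imp: "?eq \<delta>" if "factors_as D F \<alpha> (causal_counit D E) \<delta>" for \<delta>
    using that by (simp add: factors_as_def ordinals_def ordinal_omega)
  have uniq: "?eq \<gamma> \<Longrightarrow> \<gamma> = causal_transpose D F \<alpha>" by (rule causal_transpose_unique[OF \<gamma>])
  show "factors_as D F \<alpha> (causal_counit D E) \<gamma> \<longleftrightarrow> \<gamma> = causal_transpose D F \<alpha>"
    using imp[of \<gamma>] uniq causal_transpose_factors by metis
  show "?eq \<gamma> \<longleftrightarrow> \<gamma> = causal_transpose D F \<alpha>"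
    using imp[OF causal_transpose_factors] uniq by metis
qed

end

lemma causal_functor_right_Kan_extension:
  "is_right_Kan_extension D E (causal_functor D E) (causal_counit D E)"
  unfolding is_right_Kan_extension_def
proof (intro conjI allI impI is_functor_causal_functor causal_counit_chain_trans)
  fix H \<alpha> assume "is_functor H \<and> is_chain_trans ordinals (map_chain H D) E \<alpha>"
  then have H: "is_functor H" "is_chain_trans ordinals (map_chain H D) E \<alpha>" by simp_all
  show "\<exists>!\<gamma>. is_nat_trans H (causal_functor D E) \<gamma> \<and> factors_as D H \<alpha> (causal_counit D E) \<gamma>"
    by (rule ex1I[of _ "causal_transpose D H \<alpha>"])
      (auto simp: causal_transpose_nat_trans[OF H] causal_transpose_factors[OF H]
        dest: factors_as_iff(1)[OF H, THEN iffD1])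
qed

end

theorem theorem8p8:
  fixes A B :: "'v::zfc_universe set_functor" and Abar Bbar :: "'v chain"
  assumes "is_functor A" and "is_functor B"
    and "omega_continuous A" and "omega_continuous B"
    and "is_final_sequence A Abar" and "is_final_sequence B Bbar"
  shows "\<exists>\<epsilon>.
    is_right_Kan_extension Abar Bbar (causal_functor Abar Bbar) \<epsilon> \<and>
    (\<forall>\<alpha>\<in>elts (causal_obj Abar Bbar (cob Abar ord_omega)).
       \<epsilon> ord_omega \<alpha> = vapp \<alpha> (vlambda (cob Abar ord_omega) (idm (cob Abar ord_omega)))) \<and>
    (\<forall>F \<alpha>. is_functor F \<and> is_chain_trans ordinals (map_chain F Abar) Bbar \<alpha> \<longrightarrow>
       is_nat_trans F (causal_functor Abar Bbar) (causal_transpose Abar F \<alpha>) \<and>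
       (\<forall>\<gamma>. is_nat_trans F (causal_functor Abar Bbar) \<gamma> \<longrightarrow>
          (factors_as Abar F \<alpha> \<epsilon> \<gamma> \<longleftrightarrow> \<gamma> = causal_transpose Abar F \<alpha>) \<and>
          (compose (elts (Ob F (cob Abar ord_omega))) (\<epsilon> ord_omega) (\<gamma> (cob Abar ord_omega)) = \<alpha> ord_omega
             \<longleftrightarrow> \<gamma> = causal_transpose Abar F \<alpha>)))"
proof -
  note hyps = assms(1,2,4,5,6)
  show ?thesis
  proof (intro exI[of _ "causal_counit Abar Bbar"] conjI ballI allI impI; (elim conjE)?)
    show "is_right_Kan_extension Abar Bbar (causal_functor Abar Bbar) (causal_counit Abar Bbar)"
      by (rule causal_functor_right_Kan_extension[OF hyps])
  qed (simp_all only: elts_causal_obj mem_Collect_eq causal_counit_omega[OF hyps]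
      causal_transpose_nat_trans[OF hyps] factors_as_iff[OF hyps])
qed

end
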